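(* Let $\mu,\sigma\in\mathbb{R}$, $T>0$, and let $X(t)$, $0\le t\le T$, be the solution of the Itô equation $dX(t)=\mu X(t)\,dt+\sigma X(t)\,dW(t)$ with initial condition $X(0)=X_0$. The numerical scheme $$\tilde X_{2n+1}=\alpha_n\tilde X_{2n},\qquad \tilde X_{2n+2}=\beta_n\tilde X_{2n},\qquad n=0,1,\dots,\tfrac{N-2}{2},$$ with $\alpha_n,\beta_n$ as given in the context, is mean-square consistent for approximating $X$: its local errors $\delta_n$ (defined in the context) satisfy $$\mathbb{E}\left(|\delta_n|^2\right)\le C\,\Delta t^{p}\qquad\text{as }\Delta t\to 0$$ for some constants $p\ge 1$ and $C>0$.
   Context: $(\Omega,\mathcal F,P;\mathcal F_t)$ is a filtered probability space, $W(t)$ is a standard Wiener process adapted to $\mathcal F_t$ (continuous, $W(0)=0$, an $\mathcal F_t$-martingale with $\mathbb E((W(t)-W(s))^2\mid\mathcal F_s)=t-s$ for $t\ge s$), and $X(t)$ is continuous and $\mathcal F_t$-adapted. The interval $[0,T]$ is divided by the uniform grid $t_i=i\Delta t$, $i=0,\dots,N$, with $N$ even and $t_N=T$. Write $$\Delta W_{2n}=W(t_{2n+1})-W(t_{2n}),\qquad (E^2-1)W_{2n}=W(t_{2n+2})-W(t_{2n}).$$ The coefficients of the scheme are $$\alpha_n=\frac{1-\frac{(\mu\Delta t)^2}{6}-\sigma\frac{\mu\Delta t}{12}(E^2-1)W_{2n}+\sigma\left(1-\frac{\mu\Delta t}{3}\right)\Delta W_{2n}}{1-\mu\Delta t+\frac{(\mu\Delta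 t)^2}{3}},\qquad \beta_n=\frac{1+\frac{\mu\Delta t}{3}+\frac{4\mu\Delta t}{3}\alpha_n+\sigma(E^2-1)W_{2n}}{1-\frac{\mu\Delta t}{3}}.$$ Equivalently (for $\mu\Delta t\ne 3$), $(\tilde X_{2n+1},\tilde X_{2n+2})$ is the solution of the linear system $$\tilde X_{2n+2}-\tilde X_{2n}=\mu\left(\tfrac{\Delta t}{3}\tilde X_{2n}+\tfrac{4\Delta t}{3}\tilde X_{2n+1}+\tfrac{\Delta t}{3}\tilde X_{2n+2}\right)+\sigma\tilde X_{2n}(E^2-1)W_{2n},$$ $$\tilde X_{2n+1}-\tilde X_{2n}=\mu\left(\tfrac{5\Delta t}{12}\tilde X_{2n}+\tfrac{2\Delta t}{3}\tilde X_{2n+1}-\tfrac{\Delta t}{12}\tilde X_{2n+2}\right)+\sigma\tilde X_{2n}\Delta W_{2n}.$$ Local error: $\delta_n=X(t_n)-\tilde X(t_n)$, where $\tilde X(t_n)$ denotes the locally approximate value obtained by one step of these formulas with the exact solution values inserted on the right-hand side, namely $$\tilde X(t_{2n+2})=X(t_{2n})+\mu\left(\tfrac{\Delta t}{3}X(t_{2n})+\tfrac{4\Delta t}{3}X(t_{2n+1})+\tfrac{\Delta t}{3}X(t_{2n+2})\right)+\sigma X(t_{2n})(E^2-1)W_{2n},$$ $$\tilde X(t_{2n+1})=X(t_{2n})+\mu\left(\tfrac{5\Delta t}{12}X(t_{2n})+\tfrac{2\Delta t}{3}X(t_{2n+1})-\tfrac{\Delta t}{12}X(t_{2n+2})\right)+\sigma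 X(t_{2n})\Delta W_{2n}.$$ The constants $C$ and $p$ do not depend on $\Delta t$ or on the index $n$; "as $\Delta t\to0$" means for all sufficiently small $\Delta t$.
   Formalization: The initial value X_0 is taken to be F_0-measurable with finite second moment (deterministic X_0 included); for random X_0 with infinite second moment E|δ_n|² is in general infinite and the claim fails. *)

theory Defs
  imports "HOL-Probability.Probability"
begin

section \<open>Filtrations and Wiener processes\<close>

text \<open>Time runs through the nonnegative reals; the values of \<open>F\<close>, \<open>W\<close> at negative times are
  irrelevant. No completeness or right-continuity of the filtration is assumed, and path
  properties are required almost surely.\<close>

definition filtered_prob_space :: "'a measure \<Rightarrow> (real \<Rightarrow> 'a measure) \<Rightarrow> bool" where
  "filtered_prob_space M F \<longleftrightarrow>
     prob_space M \<and>
     (\<forall>t\<ge>0. subalgebra M (F t)) \<and>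
     (\<forall>s t. 0 \<le> s \<and> s \<le> t \<longrightarrow> sets (F s) \<subseteq> sets (F t))"

definition adapted_on :: "real set \<Rightarrow> (real \<Rightarrow> 'a measure) \<Rightarrow> (real \<Rightarrow> 'a \<Rightarrow> real) \<Rightarrow> bool" where
  "adapted_on I F X \<longleftrightarrow> (\<forall>t\<in>I. X t \<in> borel_measurable (F t))"

text \<open>Integrability is stated separately from the conditional expectations because
  \<open>real_cond_exp\<close> is total.\<close>

definition martingale_wrt :: "'a measure \<Rightarrow> (real \<Rightarrow> 'a measure) \<Rightarrow> (real \<Rightarrow> 'a \<Rightarrow> real) \<Rightarrow> bool" where
  "martingale_wrt M F W \<longleftrightarrow>
     adapted_on {0..} F W \<and>
     (\<forall>t\<ge>0. integrable M (W t)) \<and>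
     (\<forall>s t. 0 \<le> s \<and> s \<le> t \<longrightarrow> (AE \<omega> in M. real_cond_exp M (F s) (W t) \<omega> = W s \<omega>))"

definition wiener_process :: "'a measure \<Rightarrow> (real \<Rightarrow> 'a measure) \<Rightarrow> (real \<Rightarrow> 'a \<Rightarrow> real) \<Rightarrow> bool" where
  "wiener_process M F W \<longleftrightarrow>
     (AE \<omega> in M. W 0 \<omega> = 0) \<and>
     (AE \<omega> in M. continuous_on {0..} (\<lambda>t. W t \<omega>)) \<and>
     martingale_wrt M F W \<and>
     (\<forall>s t. 0 \<le> s \<and> s \<le> t \<longrightarrow>
        integrable M (\<lambda>\<omega>. (W t \<omega> - W s \<omega>)\<^sup>2) \<and>
        (AE \<omega> in M. real_cond_exp M (F s) (\<lambda>\<omega>. (W t \<omega> - W s \<omega>)\<^sup>2) \<omega> = t - s))"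

section \<open>The Ito integral\<close>

text \<open>A triple \<open>(m, s, \<xi>)\<close> stands for the step process with value \<open>\<xi> i\<close> on the interval
  from \<open>s i\<close> (excluded) to \<open>s (Suc i)\<close> (included), for \<open>i < m\<close>, and \<open>0\<close> elsewhere.\<close>

type_synonym 'a step = "nat \<times> (nat \<Rightarrow> real) \<times> (nat \<Rightarrow> 'a \<Rightarrow> real)"

fun nonanticipating_step :: "(real \<Rightarrow> 'a measure) \<Rightarrow> 'a step \<Rightarrow> bool" where
  "nonanticipating_step F (m, s, \<xi>) \<longleftrightarrow>
     0 \<le> s 0 \<and> (\<forall>i<m. s i < s (Suc i)) \<and> (\<forall>i<m. \<xi> i \<in> borel_measurable (F (s i)))"

fun step_value :: "'a step \<Rightarrow> real \<Rightarrow> 'a \<Rightarrow> real" where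
  "step_value (m, s, \<xi>) t \<omega> = (\<Sum>i<m. \<xi> i \<omega> * indicator {s i<..s (Suc i)} t)"

fun step_integral :: "(real \<Rightarrow> 'a \<Rightarrow> real) \<Rightarrow> 'a step \<Rightarrow> real \<Rightarrow> 'a \<Rightarrow> real" where
  "step_integral W (m, s, \<xi>) t \<omega> =
     (\<Sum>i<m. \<xi> i \<omega> * (W (min t (s (Suc i))) \<omega> - W (min t (s i)) \<omega>))"

text \<open>\<open>has_ito_integral M F W T H I\<close>: \<open>H\<close> is an admissible integrand on \<open>[0,T]\<close> (jointly
  measurable, adapted, almost surely square integrable in time), and \<open>I t\<close> is the Ito integral
  of \<open>H\<close> with respect to \<open>W\<close> from \<open>0\<close> to \<open>t\<close>, that is, the limit in probability of the
  integrals of step processes approximating \<open>H\<close> in the sense that the time integral of the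
  squared difference tends to \<open>0\<close> in probability. No moments of \<open>H\<close> are required. The
  measurability requirements make all events below members of \<open>sets M\<close>.\<close>

definition has_ito_integral ::
  "'a measure \<Rightarrow> (real \<Rightarrow> 'a measure) \<Rightarrow> (real \<Rightarrow> 'a \<Rightarrow> real) \<Rightarrow> real \<Rightarrow>
   (real \<Rightarrow> 'a \<Rightarrow> real) \<Rightarrow> (real \<Rightarrow> 'a \<Rightarrow> real) \<Rightarrow> bool" where
  "has_ito_integral M F W T H I \<longleftrightarrow>
     (\<lambda>(t, \<omega>). H t \<omega>) \<in> borel_measurable (restrict_space borel {0..T} \<Otimes>\<^sub>M M) \<and>
     adapted_on {0..T} F H \<and>
     (AE \<omega> in M. (\<integral>\<^sup>+ t\<in>{0..T}. ennreal ((H t \<omega>)\<^sup>2) \<partial>lborel) < \<infinity>) \<and>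
     (\<forall>t\<in>{0..T}. I t \<in> borel_measurable M) \<and>
     (\<exists>\<Phi> :: nat \<Rightarrow> 'a step.
        (\<forall>k. nonanticipating_step F (\<Phi> k)) \<and>
        (\<forall>\<epsilon>>0. (\<lambda>k. measure M {\<omega> \<in> space M.
             (\<integral>\<^sup>+ t\<in>{0..T}. ennreal ((H t \<omega> - step_value (\<Phi> k) t \<omega>)\<^sup>2) \<partial>lborel) > ennreal \<epsilon>})
           \<longlonglongrightarrow> 0) \<and>
        (\<forall>t\<in>{0..T}. \<forall>\<epsilon>>0. (\<lambda>k. measure M {\<omega> \<in> space M.
             \<bar>step_integral W (\<Phi> k) t \<omega> - I t \<omega>\<bar> > \<epsilon>}) \<longlonglongrightarrow> 0))"

text \<open>Solutions on \<open>[0,T]\<close> of the linear equation \<open>dX = \<mu> X dt + \<sigma> X dW\<close>, \<open>X 0 = X0\<close>,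
  in integral form.\<close>

definition ito_linear_solution ::
  "'a measure \<Rightarrow> (real \<Rightarrow> 'a measure) \<Rightarrow> (real \<Rightarrow> 'a \<Rightarrow> real) \<Rightarrow> real \<Rightarrow> real \<Rightarrow> real \<Rightarrow>
   ('a \<Rightarrow> real) \<Rightarrow> (real \<Rightarrow> 'a \<Rightarrow> real) \<Rightarrow> bool" where
  "ito_linear_solution M F W T \<mu> \<sigma> X0 X \<longleftrightarrow>
     adapted_on {0..T} F X \<and>
     (AE \<omega> in M. continuous_on {0..T} (\<lambda>t. X t \<omega>)) \<and>
     (AE \<omega> in M. X 0 \<omega> = X0 \<omega>) \<and>
     (\<exists>I. has_ito_integral M F W T X I \<and>
        (\<forall>t\<in>{0..T}. AE \<omega> in M.
           X t \<omega> = X0 \<omega> + \<mu> * (LBINT s:{0..t}. X s \<omega>) + \<sigma> * I t \<omega>))"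

section \<open>The numerical scheme\<close>

text \<open>Everything here is pathwise: \<open>h\<close> is the step size and \<open>w\<close> a path of the Wiener process.
  \<open>dW1\<close> is the increment over the first step of the \<open>n\<close>-th block, \<open>dW2\<close> the one over the
  whole block (two steps).\<close>

definition dW1 :: "real \<Rightarrow> (real \<Rightarrow> real) \<Rightarrow> nat \<Rightarrow> real" where
  "dW1 h w n = w (real (2*n + 1) * h) - w (real (2*n) * h)"

definition dW2 :: "real \<Rightarrow> (real \<Rightarrow> real) \<Rightarrow> nat \<Rightarrow> real" where
  "dW2 h w n = w (real (2*n + 2) * h) - w (real (2*n) * h)"

definition alpha :: "real \<Rightarrow> real \<Rightarrow> real \<Rightarrow> (real \<Rightarrow> real) \<Rightarrow> nat \<Rightarrow> real" where
  "alpha \<mu> \<sigma> h w n =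
     (1 - (\<mu>*h)\<^sup>2 / 6 - \<sigma> * (\<mu>*h / 12) * dW2 h w n + \<sigma> * (1 - \<mu>*h / 3) * dW1 h w n)
     / (1 - \<mu>*h + (\<mu>*h)\<^sup>2 / 3)"

definition beta :: "real \<Rightarrow> real \<Rightarrow> real \<Rightarrow> (real \<Rightarrow> real) \<Rightarrow> nat \<Rightarrow> real" where
  "beta \<mu> \<sigma> h w n =
     (1 + \<mu>*h / 3 + 4*\<mu>*h / 3 * alpha \<mu> \<sigma> h w n + \<sigma> * dW2 h w n) / (1 - \<mu>*h / 3)"

definition scheme :: "real \<Rightarrow> real \<Rightarrow> real \<Rightarrow> (real \<Rightarrow> real) \<Rightarrow> nat \<Rightarrow> (nat \<Rightarrow> real) \<Rightarrow> bool" where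
  "scheme \<mu> \<sigma> h w N y \<longleftrightarrow>
     (\<forall>n. 2*n + 2 \<le> N \<longrightarrow>
        y (2*n + 1) = alpha \<mu> \<sigma> h w n * y (2*n) \<and>
        y (2*n + 2) = beta \<mu> \<sigma> h w n * y (2*n))"

text \<open>The right-hand sides of the implicit form of the scheme (solved for the left end point of
  the block), for the first and the second unknown of block \<open>n\<close>, as functions of the values
  \<open>x0\<close>, \<open>x1\<close>, \<open>x2\<close> at the three grid points of the block.\<close>

definition rhs1 :: "real \<Rightarrow> real \<Rightarrow> real \<Rightarrow> (real \<Rightarrow> real) \<Rightarrow> nat \<Rightarrow> real \<Rightarrow> real \<Rightarrow> real \<Rightarrow> real" where
  "rhs1 \<mu> \<sigma> h w n x0 x1 x2 =
     x0 + \<mu> * (5*h / 12 * x0 + 2*h / 3 * x1 - h / 12 * x2) + \<sigma> * x0 * dW1 h w n"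

definition rhs2 :: "real \<Rightarrow> real \<Rightarrow> real \<Rightarrow> (real \<Rightarrow> real) \<Rightarrow> nat \<Rightarrow> real \<Rightarrow> real \<Rightarrow> real \<Rightarrow> real" where
  "rhs2 \<mu> \<sigma> h w n x0 x1 x2 =
     x0 + \<mu> * (h / 3 * x0 + 4*h / 3 * x1 + h / 3 * x2) + \<sigma> * x0 * dW2 h w n"

definition implicit_scheme ::
  "real \<Rightarrow> real \<Rightarrow> real \<Rightarrow> (real \<Rightarrow> real) \<Rightarrow> nat \<Rightarrow> (nat \<Rightarrow> real) \<Rightarrow> bool" where
  "implicit_scheme \<mu> \<sigma> h w N y \<longleftrightarrow>
     (\<forall>n. 2*n + 2 \<le> N \<longrightarrow>
        y (2*n + 1) = rhs1 \<mu> \<sigma> h w n (y (2*n)) (y (2*n + 1)) (y (2*n + 2)) \<and>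
        y (2*n + 2) = rhs2 \<mu> \<sigma> h w n (y (2*n)) (y (2*n + 1)) (y (2*n + 2)))"

text \<open>The locally approximate value at grid point \<open>k \<ge> 1\<close>: one step of the formulas with the
  values of the path \<open>x\<close> inserted on the right. Grid points \<open>2*n + 1\<close> and \<open>2*n + 2\<close> belong to
  block \<open>n\<close>.\<close>

definition local_value ::
  "real \<Rightarrow> real \<Rightarrow> real \<Rightarrow> (real \<Rightarrow> real) \<Rightarrow> (real \<Rightarrow> real) \<Rightarrow> nat \<Rightarrow> real" where
  "local_value \<mu> \<sigma> h w x k =
     (let n = (k - 1) div 2;
          x0 = x (real (2*n) * h); x1 = x (real (2*n + 1) * h); x2 = x (real (2*n + 2) * h)
      in if odd k then rhs1 \<mu> \<sigma> h w n x0 x1 x2 else rhs2 \<mu> \<sigma> h w n x0 x1 x2)"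

definition local_error ::
  "real \<Rightarrow> real \<Rightarrow> real \<Rightarrow> (real \<Rightarrow> real) \<Rightarrow> (real \<Rightarrow> real) \<Rightarrow> nat \<Rightarrow> real" where
  "local_error \<mu> \<sigma> h w x k = x (real k * h) - local_value \<mu> \<sigma> h w x k"

end

theory Submission
  imports Defs
begin

text \<open>The local errors are linear combinations of an increment of \<open>X\<close>, of values of \<open>X\<close>
  times the step size, and of a value of \<open>X\<close> times the subsequent increment of \<open>W\<close>; so it
  suffices that \<open>X\<close> has bounded second moments and mean-square Lipschitz squared increments.
  Since the Ito integral is only a limit in probability, no moments of \<open>X\<close> are available a
  priori. They come from the localized isometry
  \<open>E ((I b - I a)\<^sup>2; Q < c) \<le> E (min c Q)\<close> with \<open>Q\<close> the time integral of \<open>X\<^sup>2\<close> over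
  \<open>[a, b]\<close>, obtained by stopping the approximating step processes before their quadratic
  variation exceeds \<open>c\<close>. As \<open>min c (Q t)\<close> is the time integral of \<open>X\<^sup>2\<close> restricted to
  \<open>Q < c\<close>, its expectation satisfies a Gronwall inequality with constants independent of
  \<open>c\<close>, and \<open>c\<close> may tend to infinity.\<close>

section \<open>Increments of the Wiener process\<close>

text \<open>The increment of \<open>X\<close> over one block has mean square of order
  \<open>h\<close>, which is already the order claimed. No cancellation against the quadrature or
  the stochastic term is exploited, and the quadrature weights enter only through their size; the
  work lies in the moments. The quantity \<open>Q\<close> serves instead: it is defined pathwise and
  nondecreasing in its upper limit. For a step process, the contribution of an interval to
  \<open>Q\<close> is known at the left end of that interval, so the decision to stop is
  nonanticipating. The stopped coefficients then have finite second moments against the interval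
  lengths, whatever the moments of the original ones, and the discrete isometry applies. Fatou's
  lemma carries it to the limit as an inequality, and an upper bound is all that the moment
  estimates ask for. The truncation \<open>min c Q\<close> also supplies the finite a priori bound
  without which a Gronwall inequality says nothing.\<close>

lemma square_integrableI:
  fixes f :: "'a \<Rightarrow> real"
  assumes "f \<in> borel_measurable M" "(\<integral>\<^sup>+\<omega>. ennreal ((f \<omega>)\<^sup>2) \<partial>M) < \<infinity>"
  shows "integrable M (\<lambda>\<omega>. (f \<omega>)\<^sup>2)"
  by (rule integrableI_nonneg) (use assms in auto)

lemma integrable_mult_of_square_integrable:
  fixes f g :: "'a \<Rightarrow> real"
  assumes [measurable]: "f \<in> borel_measurable M" "g \<in> borel_measurable M"
    and "integrable M (\<lambda>\<omega>. (f \<omega>)\<^sup>2)" "integrable M (\<lambda>\<omega>. (g \<omega>)\<^sup>2)"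
  shows "integrable M (\<lambda>\<omega>. f \<omega> * g \<omega>)"
proof (rule Bochner_Integration.integrable_bound[where f = "\<lambda>\<omega>. (f \<omega>)\<^sup>2 + (g \<omega>)\<^sup>2"])
  have "\<bar>a * b\<bar> \<le> a\<^sup>2 + b\<^sup>2" for a b :: real
  proof -
    have "2 * \<bar>a * b\<bar> \<le> a\<^sup>2 + b\<^sup>2"
      using sum_squares_bound[of "\<bar>a\<bar>" "\<bar>b\<bar>"] by (simp add: abs_mult)
    then show ?thesis using abs_ge_zero[of "a * b"] by linarith
  qed
  then show "AE \<omega> in M. norm (f \<omega> * g \<omega>) \<le> norm ((f \<omega>)\<^sup>2 + (g \<omega>)\<^sup>2)" by auto
qed (use assms in auto)

locale wiener_space = prob_space M for M :: "'a measure" +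
  fixes F :: "real \<Rightarrow> 'a measure" and W :: "real \<Rightarrow> 'a \<Rightarrow> real"
  assumes filtration: "filtered_prob_space M F" and wiener: "wiener_process M F W"
begin

lemma subalgebra_F: "0 \<le> t \<Longrightarrow> subalgebra M (F t)"
  using filtration unfolding filtered_prob_space_def by auto

lemma measurable_F_M: "f \<in> borel_measurable (F t) \<Longrightarrow> 0 \<le> t \<Longrightarrow> f \<in> borel_measurable M"
  using measurable_from_subalg subalgebra_F by blast

lemma measurable_F_mono:
  assumes "f \<in> borel_measurable (F s)" "0 \<le> s" "s \<le> t" shows "f \<in> borel_measurable (F t)"
proof -
  have "subalgebra (F t) (F s)"
    using filtration subalgebra_F[of s] subalgebra_F[of t] assms unfolding filtered_prob_space_def subalgebra_def by auto
  then show ?thesis using assms measurable_from_subalg by blast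
qed

lemma measurable_W_F: "0 \<le> t \<Longrightarrow> W t \<in> borel_measurable (F t)"
  using wiener unfolding wiener_process_def martingale_wrt_def adapted_on_def by auto

lemma measurable_W: "0 \<le> t \<Longrightarrow> W t \<in> borel_measurable M"
  using measurable_F_M measurable_W_F by blast

lemma finite_measure_subalgebra_F: "0 \<le> t \<Longrightarrow> finite_measure_subalgebra M (F t)"
  using subalgebra_F finite_measure_axioms by (simp add: finite_measure_subalgebra_def finite_measure_subalgebra_axioms_def)

text \<open>Stated for \<open>ennreal\<close>-valued \<open>f\<close>, so that it can be used before
  any finiteness is known. The hypothesis concerns \<open>real_cond_exp\<close>; the constant
  \<open>t - s\<close> is recognized as a version of \<open>nn_cond_exp\<close> by comparing
  integrals over the sets of \<open>F s\<close>.\<close>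

lemma nn_integral_mult_increment_sq:
  fixes f :: "'a \<Rightarrow> ennreal"
  assumes s: "0 \<le> s" "s \<le> t" and f: "f \<in> borel_measurable (F s)"
  shows "(\<integral>\<^sup>+\<omega>. f \<omega> * ennreal ((W t \<omega> - W s \<omega>)\<^sup>2) \<partial>M) = ennreal (t - s) * (\<integral>\<^sup>+\<omega>. f \<omega> \<partial>M)"
proof -
  interpret S: finite_measure_subalgebra M "F s" using finite_measure_subalgebra_F s by simp
  let ?d = "\<lambda>\<omega>. (W t \<omega> - W s \<omega>)\<^sup>2"
  have [measurable]: "W s \<in> borel_measurable M" "W t \<in> borel_measurable M" using s measurable_W by auto
  have [measurable]: "f \<in> borel_measurable M" using f measurable_F_M s by auto
  have int: "integrable M ?d" and ce: "AE \<omega> in M. real_cond_exp M (F s) ?d \<omega> = t - s"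
    using wiener s unfolding wiener_process_def by auto
  have "(\<integral>\<^sup>+\<omega>\<in>A. ennreal (?d \<omega>) \<partial>M) = (\<integral>\<^sup>+\<omega>\<in>A. ennreal (t - s) \<partial>M)" if A: "A \<in> sets (F s)" for A
  proof -
    have AM[measurable]: "A \<in> sets M" using A subalgebra_F[of s] s unfolding subalgebra_def by auto
    have "(\<integral>\<^sup>+\<omega>\<in>A. ennreal (?d \<omega>) \<partial>M) = (\<integral>\<^sup>+\<omega>. ennreal (indicator A \<omega> * ?d \<omega>) \<partial>M)"
      by (intro nn_integral_cong) (auto simp: indicator_def)
    also have "\<dots> = ennreal (\<integral>\<omega>. indicator A \<omega> * ?d \<omega> \<partial>M)"
      using integrable_mult_indicator[OF AM int] by (intro nn_integral_eq_integral) auto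
    also have "(\<integral>\<omega>. indicator A \<omega> * ?d \<omega> \<partial>M) = (\<integral>\<omega>\<in>A. real_cond_exp M (F s) ?d \<omega> \<partial>M)"
      using S.real_cond_exp_intA[OF int A] by (simp add: set_lebesgue_integral_def)
    also have "\<dots> = (\<integral>\<omega>\<in>A. (t - s) \<partial>M)"
      unfolding set_lebesgue_integral_def by (intro integral_cong_AE) (use ce in auto)
    also have "\<dots> = (t - s) * measure M A" by (simp add: set_lebesgue_integral_def)
    also have "ennreal \<dots> = (\<integral>\<^sup>+\<omega>\<in>A. ennreal (t - s) \<partial>M)"
      using s by (simp add: nn_integral_cmult emeasure_eq_measure ennreal_mult)
    finally show ?thesis .
  qed
  then have "AE \<omega> in M. ennreal (t - s) = nn_cond_exp M (F s) (\<lambda>\<omega>. ennreal (?d \<omega>)) \<omega>"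
    by (intro S.nn_cond_exp_charact) auto
  then have "(\<integral>\<^sup>+\<omega>. f \<omega> * nn_cond_exp M (F s) (\<lambda>\<omega>. ennreal (?d \<omega>)) \<omega> \<partial>M) = (\<integral>\<^sup>+\<omega>. f \<omega> * ennreal (t - s) \<partial>M)"
    by (intro nn_integral_cong_AE) auto
  then show ?thesis using S.nn_cond_exp_intg[OF f, of "\<lambda>\<omega>. ennreal (?d \<omega>)"]
    by (simp add: nn_integral_multc mult.commute)
qed

lemma integral_mult_increment:
  assumes s: "0 \<le> s" "s \<le> t" and f: "f \<in> borel_measurable (F s)"
    and int: "integrable M (\<lambda>\<omega>. f \<omega> * (W t \<omega> - W s \<omega>))"
  shows "(\<integral>\<omega>. f \<omega> * (W t \<omega> - W s \<omega>) \<partial>M) = 0"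
proof -
  interpret S: finite_measure_subalgebra M "F s" using finite_measure_subalgebra_F s by simp
  have [measurable]: "W s \<in> borel_measurable M" "W t \<in> borel_measurable M" "f \<in> borel_measurable M"
    using s measurable_W f measurable_F_M by auto
  have iW: "integrable M (W s)" "integrable M (W t)" 
    and ce: "AE \<omega> in M. real_cond_exp M (F s) (W t) \<omega> = W s \<omega>"
    using wiener s unfolding wiener_process_def martingale_wrt_def by auto
  have "AE \<omega> in M. real_cond_exp M (F s) (\<lambda>\<omega>. W t \<omega> - W s \<omega>) \<omega> = 0"
    using S.real_cond_exp_diff[OF iW(2,1)] S.real_cond_exp_F_meas[OF iW(1) measurable_W_F[OF s(1)]] ce by auto
  then have "(\<integral>\<omega>. f \<omega> * real_cond_exp M (F s) (\<lambda>\<omega>. W t \<omega> - W s \<omega>) \<omega> \<partial>M) = (\<integral>\<omega>. 0 \<partial>M)"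
    by (intro integral_cong_AE) auto
  then show ?thesis using S.real_cond_exp_intg(2)[OF int f] by simp
qed

lemma ito_isometry_discrete:
  assumes u0: "0 \<le> u 0" and u: "\<And>i. i < m \<Longrightarrow> u i \<le> u (Suc i)"
    and \<zeta>: "\<And>i. i < m \<Longrightarrow> \<zeta> i \<in> borel_measurable (F (u i))"
    and fin: "\<And>i. i < m \<Longrightarrow> (\<integral>\<^sup>+\<omega>. ennreal ((\<zeta> i \<omega>)\<^sup>2) * ennreal (u (Suc i) - u i) \<partial>M) < \<infinity>"
  shows "(\<integral>\<^sup>+\<omega>. ennreal ((\<Sum>i<m. \<zeta> i \<omega> * (W (u (Suc i)) \<omega> - W (u i) \<omega>))\<^sup>2) \<partial>M)
     = (\<Sum>i<m. \<integral>\<^sup>+\<omega>. ennreal ((\<zeta> i \<omega>)\<^sup>2) * ennreal (u (Suc i) - u i) \<partial>M)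
   \<and> (\<lambda>\<omega>. \<Sum>i<m. \<zeta> i \<omega> * (W (u (Suc i)) \<omega> - W (u i) \<omega>)) \<in> borel_measurable (F (u m)) \<and> 0 \<le> u m"
  using u \<zeta> fin
proof (induction m)
  case 0
  then show ?case using u0 by simp
next
  case (Suc m)
  let ?d = "\<lambda>i \<omega>. W (u (Suc i)) \<omega> - W (u i) \<omega>"
  define J where "J \<omega> = (\<Sum>i<m. \<zeta> i \<omega> * ?d i \<omega>)" for \<omega>
  let ?S = "\<Sum>i<m. \<integral>\<^sup>+\<omega>. ennreal ((\<zeta> i \<omega>)\<^sup>2) * ennreal (u (Suc i) - u i) \<partial>M"
  let ?T = "\<integral>\<^sup>+\<omega>. ennreal ((\<zeta> m \<omega>)\<^sup>2) * ennreal (u (Suc m) - u m) \<partial>M"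
  have J: "(\<integral>\<^sup>+\<omega>. ennreal ((J \<omega>)\<^sup>2) \<partial>M) = ?S" and JF: "J \<in> borel_measurable (F (u m))" and um: "0 \<le> u m"
    using Suc.IH Suc.prems unfolding J_def by auto
  have le: "u m \<le> u (Suc m)" using Suc.prems by simp
  have \<zeta>F: "\<zeta> m \<in> borel_measurable (F (u m))" using Suc.prems by simp
  have [measurable]: "\<zeta> m \<in> borel_measurable M" "J \<in> borel_measurable M" "?d m \<in> borel_measurable M"
    using measurable_F_M \<zeta>F JF um le measurable_W by auto
  have D: "(\<integral>\<^sup>+\<omega>. ennreal ((\<zeta> m \<omega> * ?d m \<omega>)\<^sup>2) \<partial>M) = ?T"
    using nn_integral_mult_increment_sq[OF um le, of "\<lambda>\<omega>. ennreal ((\<zeta> m \<omega>)\<^sup>2)"] \<zeta>F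
    by (simp add: power_mult_distrib ennreal_mult nn_integral_multc nn_integral_cmult mult.commute[of _ "ennreal (_ - _)"])
  have S_fin: "?S < \<infinity>" and T_fin: "?T < \<infinity>" using Suc.prems by (auto simp: less_top)
  have iJ: "integrable M (\<lambda>\<omega>. (J \<omega>)\<^sup>2)" using S_fin J by (intro square_integrableI) auto
  have iD: "integrable M (\<lambda>\<omega>. (\<zeta> m \<omega> * ?d m \<omega>)\<^sup>2)" using T_fin D by (intro square_integrableI) auto
  have iX: "integrable M (\<lambda>\<omega>. J \<omega> * (\<zeta> m \<omega> * ?d m \<omega>))"
    using iJ iD by (intro integrable_mult_of_square_integrable) auto
  have X0: "(\<integral>\<omega>. J \<omega> * (\<zeta> m \<omega> * ?d m \<omega>) \<partial>M) = 0"
    using integral_mult_increment[OF um le, of "\<lambda>\<omega>. J \<omega> * \<zeta> m \<omega>"] iX JF \<zeta>F by (simp add: mult.assoc)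
  have sq: "(J \<omega> + \<zeta> m \<omega> * ?d m \<omega>)\<^sup>2 = (J \<omega>)\<^sup>2 + (\<zeta> m \<omega> * ?d m \<omega>)\<^sup>2 + 2 * (J \<omega> * (\<zeta> m \<omega> * ?d m \<omega>))" for \<omega>
    by (simp add: power2_eq_square algebra_simps)
  have i2: "integrable M (\<lambda>\<omega>. (J \<omega> + \<zeta> m \<omega> * ?d m \<omega>)\<^sup>2)"
    unfolding sq using iJ iD iX by auto
  have "(\<integral>\<^sup>+\<omega>. ennreal ((J \<omega> + \<zeta> m \<omega> * ?d m \<omega>)\<^sup>2) \<partial>M) = ennreal (\<integral>\<omega>. (J \<omega> + \<zeta> m \<omega> * ?d m \<omega>)\<^sup>2 \<partial>M)"
    using i2 by (intro nn_integral_eq_integral) auto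
  also have "\<dots> = ennreal ((\<integral>\<omega>. (J \<omega>)\<^sup>2 \<partial>M) + (\<integral>\<omega>. (\<zeta> m \<omega> * ?d m \<omega>)\<^sup>2 \<partial>M))"
    unfolding sq using iJ iD iX X0 by simp
  also have "\<dots> = (\<integral>\<^sup>+\<omega>. ennreal ((J \<omega>)\<^sup>2) \<partial>M) + (\<integral>\<^sup>+\<omega>. ennreal ((\<zeta> m \<omega> * ?d m \<omega>)\<^sup>2) \<partial>M)"
    using iJ iD by (simp add: nn_integral_eq_integral)
  finally have 1: "(\<integral>\<^sup>+\<omega>. ennreal ((J \<omega> + \<zeta> m \<omega> * ?d m \<omega>)\<^sup>2) \<partial>M) = ?S + ?T" using J D by simp
  have "J \<in> borel_measurable (F (u (Suc m)))" "\<zeta> m \<in> borel_measurable (F (u (Suc m)))"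
    "W (u m) \<in> borel_measurable (F (u (Suc m)))" "W (u (Suc m)) \<in> borel_measurable (F (u (Suc m)))"
    using measurable_F_mono JF \<zeta>F um le measurable_W_F by auto
  then have "(\<lambda>\<omega>. J \<omega> + \<zeta> m \<omega> * ?d m \<omega>) \<in> borel_measurable (F (u (Suc m)))" by measurable
  then show ?case using 1 um le unfolding J_def by simp
qed

end

section \<open>Integrals of step processes\<close>

lemma sum_power2_eq_if_orthogonal:
  fixes x :: "nat \<Rightarrow> real"
  assumes "\<And>i j. i < m \<Longrightarrow> j < m \<Longrightarrow> i \<noteq> j \<Longrightarrow> x i * x j = 0"
  shows "(\<Sum>i<m. x i)\<^sup>2 = (\<Sum>i<m. (x i)\<^sup>2)"
  using assms
proof (induction m)
  case (Suc m)
  have "(\<Sum>i<m. x i) * x m = 0"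
    unfolding sum_distrib_right by (rule sum.neutral) (use Suc.prems in auto)
  moreover have "(\<Sum>i<m. x i)\<^sup>2 = (\<Sum>i<m. (x i)\<^sup>2)" using Suc by simp
  ultimately show ?case by (simp add: power2_sum)
qed simp

lemma step_grid_mono:
  assumes "nonanticipating_step F (m, s, \<xi>)" "i \<le> j" "j \<le> m"
  shows "s i \<le> s j"
  using assms(2,3)
proof (induction j rule: dec_induct)
  case (step j)
  then have "s j < s (Suc j)" using assms(1) by simp
  then show ?case using step by linarith
qed simp

text \<open>The half-open intervals of the grid are disjoint, so all cross terms vanish at every
  \<open>t\<close> and every \<open>\<omega>\<close>.\<close>

lemma step_value_power2:
  assumes "nonanticipating_step F (m, s, \<xi>)"
  shows "(step_value (m, s, \<xi>) t \<omega>)\<^sup>2 = (\<Sum>i<m. (\<xi> i \<omega>)\<^sup>2 * indicator {s i<..s (Suc i)} t)"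
proof -
  have "indicator {s i<..s (Suc i)} t * indicator {s j<..s (Suc j)} t = (0::real)"
    if "i < m" "j < m" "i \<noteq> j" for i j
    using step_grid_mono[OF assms, of "Suc i" j] step_grid_mono[OF assms, of "Suc j" i] that
    by (cases "i < j") (auto simp: indicator_def)
  then have "(step_value (m, s, \<xi>) t \<omega>)\<^sup>2 = (\<Sum>i<m. (\<xi> i \<omega> * indicator {s i<..s (Suc i)} t)\<^sup>2)"
    unfolding step_value.simps by (intro sum_power2_eq_if_orthogonal) (auto simp: mult_ac)
  also have "\<dots> = (\<Sum>i<m. (\<xi> i \<omega>)\<^sup>2 * indicator {s i<..s (Suc i)} t)"
    by (intro sum.cong) (auto simp: indicator_def)
  finally show ?thesis .
qed

text \<open>Clamping both end points to \<open>[a, b]\<close> gives one formula that also covers an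
  empty intersection. The same clamped times occur in \<open>step_integral_diff\<close>, so energies
  and integrals live on one grid.\<close>

lemma emeasure_Icc_Int_Ioc:
  fixes a b l r :: real
  assumes "a \<le> b" "l \<le> r"
  shows "emeasure lborel ({a..b} \<inter> {l<..r}) = ennreal (max a (min b r) - max a (min b l))"
proof (cases "l < a")
  case True
  then have "{a..b} \<inter> {l<..r} = {a..min b r}" by auto
  then show ?thesis using True assms by (auto simp: emeasure_lborel_Icc_eq max_def min_def)
next
  case False
  then have eq: "{a..b} \<inter> {l<..r} = {l<..min b r}" by auto
  show ?thesis
  proof (cases "l \<le> b")
    case True
    then show ?thesis unfolding eq using False assms by (subst emeasure_lborel_Ioc) (auto simp: max_def min_def)
  next
    case F: False
    then have "{l<..min b r} = {}" by auto
    then show ?thesis unfolding eq using F assms by simp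
  qed
qed

lemma nn_integral_step_value_power2:
  assumes "nonanticipating_step F (m, s, \<xi>)" "a \<le> b"
  shows "(\<integral>\<^sup>+t\<in>{a..b}. ennreal ((step_value (m, s, \<xi>) t \<omega>)\<^sup>2) \<partial>lborel)
    = ennreal (\<Sum>i<m. (\<xi> i \<omega>)\<^sup>2 * (max a (min b (s (Suc i))) - max a (min b (s i))))"
proof -
  have le: "s i \<le> s (Suc i)" if "i < m" for i using step_grid_mono[OF assms(1), of i "Suc i"] that by simp
  have "(\<integral>\<^sup>+t\<in>{a..b}. ennreal ((step_value (m, s, \<xi>) t \<omega>)\<^sup>2) \<partial>lborel)
     = (\<integral>\<^sup>+t. (\<Sum>i<m. ennreal ((\<xi> i \<omega>)\<^sup>2) * indicator ({a..b} \<inter> {s i<..s (Suc i)}) t) \<partial>lborel)"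
  proof (intro nn_integral_cong)
    fix t
    have "ennreal (\<Sum>i<m. (\<xi> i \<omega>)\<^sup>2 * indicator {s i<..s (Suc i)} t) * indicator {a..b} t
      = (\<Sum>i<m. ennreal ((\<xi> i \<omega>)\<^sup>2 * indicator {s i<..s (Suc i)} t)) * indicator {a..b} t"
      by (subst sum_ennreal) auto
    also have "\<dots> = (\<Sum>i<m. ennreal ((\<xi> i \<omega>)\<^sup>2) * indicator ({a..b} \<inter> {s i<..s (Suc i)}) t)"
      unfolding sum_distrib_right by (intro sum.cong) (auto simp: indicator_def)
    finally show "ennreal ((step_value (m, s, \<xi>) t \<omega>)\<^sup>2) * indicator {a..b} t
      = (\<Sum>i<m. ennreal ((\<xi> i \<omega>)\<^sup>2) * indicator ({a..b} \<inter> {s i<..s (Suc i)}) t)"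
      unfolding step_value_power2[OF assms(1)] .
  qed
  also have "\<dots> = (\<Sum>i<m. ennreal ((\<xi> i \<omega>)\<^sup>2) * emeasure lborel ({a..b} \<inter> {s i<..s (Suc i)}))"
    by (subst nn_integral_sum) (auto intro!: sum.cong nn_integral_cmult_indicator)
  also have "\<dots> = (\<Sum>i<m. ennreal ((\<xi> i \<omega>)\<^sup>2 * (max a (min b (s (Suc i))) - max a (min b (s i)))))"
    using le assms(2) by (intro sum.cong) (auto simp: emeasure_Icc_Int_Ioc ennreal_mult')
  also have "\<dots> = ennreal (\<Sum>i<m. (\<xi> i \<omega>)\<^sup>2 * (max a (min b (s (Suc i))) - max a (min b (s i))))"
    using le assms(2) by (intro sum_ennreal mult_nonneg_nonneg) (fastforce simp: max_def min_def)+
  finally show ?thesis .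
qed

lemma step_integral_diff:
  assumes "a \<le> b"
  shows "step_integral W (m, s, \<xi>) b \<omega> - step_integral W (m, s, \<xi>) a \<omega>
    = (\<Sum>i<m. \<xi> i \<omega> * (W (max a (min b (s (Suc i)))) \<omega> - W (max a (min b (s i))) \<omega>))"
proof -
  \<comment> \<open>Checked in the three positions of \<open>x\<close> relative to
    \<open>[a, b]\<close>; the constant \<open>W a\<close> cancels in each summand below.\<close>
  have clamp: "W (max a (min b x)) \<omega> = W (min b x) \<omega> - W (min a x) \<omega> + W a \<omega>" for x
    using assms by (auto simp: max_def min_def)
  show ?thesis
    unfolding clamp step_integral.simps sum_subtractf[symmetric] by (intro sum.cong) (simp_all add: algebra_simps)
qed

text \<open>The partial sums increase, so the retained terms form an initial segment, up to
  vanishing terms. The test for index \<open>i\<close> includes \<open>a i\<close> itself, hence the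
  retained total never passes \<open>c\<close>.\<close>

lemma sum_stopped_le:
  fixes a :: "nat \<Rightarrow> real"
  assumes "0 \<le> c" "\<And>i. i < m \<Longrightarrow> 0 \<le> a i"
  shows "(\<Sum>i<m. if (\<Sum>j\<le>i. a j) \<le> c then a i else 0) \<le> min c (\<Sum>i<m. a i)"
  using assms(2)
proof (induction m)
  case (Suc m)
  let ?f = "\<lambda>i. if (\<Sum>j\<le>i. a j) \<le> c then a i else 0"
  have IH: "(\<Sum>i<m. ?f i) \<le> min c (\<Sum>i<m. a i)" using Suc by simp
  show ?case
  proof (cases "(\<Sum>j\<le>m. a j) \<le> c")
    case True
    then have "?f m = a m" "(\<Sum>i<m. a i) + a m \<le> c" by (auto simp: lessThan_Suc_atMost[symmetric])
    then show ?thesis using IH by simp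
  next
    case False
    then show ?thesis using IH Suc.prems[of m] by simp
  qed
qed (use assms in simp)

context wiener_space
begin

text \<open>Stopping the step process before its quadratic variation exceeds \<open>c\<close> turns the isometry
  into a bound that needs no moments of the integrand.\<close>

lemma step_integral_truncation:
  fixes a b c :: real and \<Phi> :: "'a step"
  assumes \<Phi>: "nonanticipating_step F \<Phi>" and ab: "0 \<le> a" "a \<le> b" and c: "0 \<le> c"
  defines "q \<equiv> \<lambda>\<omega>. \<integral>\<^sup>+t\<in>{a..b}. ennreal ((step_value \<Phi> t \<omega>)\<^sup>2) \<partial>lborel"
  obtains J where "J \<in> borel_measurable M"
    "\<And>\<omega>. q \<omega> \<le> ennreal c \<Longrightarrow> J \<omega> = step_integral W \<Phi> b \<omega> - step_integral W \<Phi> a \<omega>"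
    "(\<integral>\<^sup>+\<omega>. ennreal ((J \<omega>)\<^sup>2) \<partial>M) \<le> (\<integral>\<^sup>+\<omega>. min (ennreal c) (q \<omega>) \<partial>M)"
proof -
  obtain m s \<xi> where \<Phi>_eq: "\<Phi> = (m, s, \<xi>)" by (cases \<Phi>)
  note na = \<Phi>[unfolded \<Phi>_eq]
  define u where "u i = max a (min b (s i))" for i
  \<comment> \<open>If \<open>s i > b\<close>, then \<open>u i = b\<close> and
    \<open>\<xi> i\<close> need not be known at time \<open>u i\<close>. The clamped interval is
    empty in that case, so replacing the coefficient by zero changes nothing and restores
    measurability.\<close>
  define \<eta> where "\<eta> i \<omega> = (if s i \<le> b then \<xi> i \<omega> else 0)" for i \<omega>
  define v where "v i \<omega> = (\<eta> i \<omega>)\<^sup>2 * (u (Suc i) - u i)" for i \<omega>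
  \<comment> \<open>Interval lengths are deterministic, so \<open>v i\<close> depends only on a
    coefficient known at time \<open>u i\<close>. The test can therefore include the coming interval
    and still be decided at its left end.\<close>
  define \<zeta> where "\<zeta> i \<omega> = (if (\<Sum>j\<le>i. v j \<omega>) \<le> c then \<eta> i \<omega> else 0)" for i \<omega>
  let ?J = "\<lambda>\<omega>. \<Sum>i<m. \<zeta> i \<omega> * (W (u (Suc i)) \<omega> - W (u i) \<omega>)"
  have u0: "0 \<le> u i" for i using ab by (simp add: u_def)
  have u_mono: "u i \<le> u j" if "i \<le> j" "j \<le> m" for i j
    using step_grid_mono[OF na that] by (auto simp: u_def max_def min_def)
  have degenerate: "u (Suc i) = u i" if "i < m" "\<not> s i \<le> b" for i
    using step_grid_mono[OF na, of i "Suc i"] that ab by (auto simp: u_def)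
  have \<eta>\<xi>: "v i \<omega> = (\<xi> i \<omega>)\<^sup>2 * (u (Suc i) - u i)"
    "\<eta> i \<omega> * (W (u (Suc i)) \<omega> - W (u i) \<omega>) = \<xi> i \<omega> * (W (u (Suc i)) \<omega> - W (u i) \<omega>)" if "i < m" for i \<omega>
    using degenerate[OF that] by (auto simp: v_def \<eta>_def)
  have v0: "0 \<le> v i \<omega>" if "i < m" for i \<omega> using u_mono[of i "Suc i"] that by (simp add: v_def)
  have q: "q \<omega> = ennreal (\<Sum>i<m. v i \<omega>)" for \<omega>
    unfolding q_def \<Phi>_eq nn_integral_step_value_power2[OF na ab(2)] u_def[symmetric]
    by (intro arg_cong[where f = ennreal] sum.cong) (auto simp: \<eta>\<xi>)
  have \<eta>_meas: "\<eta> i \<in> borel_measurable (F (u i))" if "i < m" for i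
  proof (cases "s i \<le> b")
    case True
    have "0 \<le> s i" using step_grid_mono[OF na, of 0 i] na that by auto
    moreover have "\<xi> i \<in> borel_measurable (F (s i))" using na that by simp
    moreover have "s i \<le> u i" using True by (simp add: u_def)
    ultimately have "\<xi> i \<in> borel_measurable (F (u i))" using measurable_F_mono by blast
    moreover have "\<eta> i = \<xi> i" using True by (simp add: fun_eq_iff \<eta>_def)
    ultimately show ?thesis by simp
  next
    case False
    then have "\<eta> i = (\<lambda>_. 0)" by (simp add: fun_eq_iff \<eta>_def)
    then show ?thesis by simp
  qed
  have \<zeta>_meas: "\<zeta> i \<in> borel_measurable (F (u i))" if "i < m" for i
  proof -
    have [measurable]: "\<eta> j \<in> borel_measurable (F (u i))" if "j \<le> i" for j
      using measurable_F_mono[OF \<eta>_meas u0 u_mono] that \<open>i < m\<close> by simp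
    have "(\<lambda>\<omega>. \<Sum>j\<le>i. v j \<omega>) \<in> borel_measurable (F (u i))"
      unfolding v_def by (intro borel_measurable_sum) measurable
    moreover have "\<eta> i \<in> borel_measurable (F (u i))" by measurable
    ultimately show ?thesis unfolding \<zeta>_def[abs_def] by measurable
  qed
  have \<zeta>v: "(\<zeta> i \<omega>)\<^sup>2 * (u (Suc i) - u i) = (if (\<Sum>j\<le>i. v j \<omega>) \<le> c then v i \<omega> else 0)" for i \<omega>
    by (simp add: \<zeta>_def v_def)
  \<comment> \<open>A retained coefficient contributes at most \<open>c\<close>, being one term of a
    sum bounded by \<open>c\<close>; this yields the finiteness demanded by the discrete isometry
    although \<open>\<xi>\<close> may have no moments.\<close>
  have \<zeta>_le: "ennreal ((\<zeta> i \<omega>)\<^sup>2) * ennreal (u (Suc i) - u i) \<le> ennreal c" if "i < m" for i \<omega>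
  proof -
    have "v i \<omega> \<le> (\<Sum>j\<le>i. v j \<omega>)" using v0 that by (intro member_le_sum) auto
    then have "(\<zeta> i \<omega>)\<^sup>2 * (u (Suc i) - u i) \<le> c" unfolding \<zeta>v using c by auto
    then show ?thesis by (simp add: ennreal_mult'[symmetric] ennreal_leI)
  qed
  have fin: "(\<integral>\<^sup>+\<omega>. ennreal ((\<zeta> i \<omega>)\<^sup>2) * ennreal (u (Suc i) - u i) \<partial>M) < \<infinity>" if "i < m" for i
  proof -
    have "(\<integral>\<^sup>+\<omega>. ennreal ((\<zeta> i \<omega>)\<^sup>2) * ennreal (u (Suc i) - u i) \<partial>M) \<le> (\<integral>\<^sup>+\<omega>. ennreal c \<partial>M)"
      by (intro nn_integral_mono \<zeta>_le that)
    also have "\<dots> < \<infinity>" by (simp add: emeasure_space_1)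
    finally show ?thesis .
  qed
  have u_Suc: "i < m \<Longrightarrow> u i \<le> u (Suc i)" for i using u_mono[of i "Suc i"] by simp
  have iso: "(\<integral>\<^sup>+\<omega>. ennreal ((?J \<omega>)\<^sup>2) \<partial>M)
      = (\<Sum>i<m. \<integral>\<^sup>+\<omega>. ennreal ((\<zeta> i \<omega>)\<^sup>2) * ennreal (u (Suc i) - u i) \<partial>M)"
    and J_meas: "?J \<in> borel_measurable (F (u m))"
    using ito_isometry_discrete[of u m \<zeta>, OF u0 u_Suc \<zeta>_meas fin] by simp_all
  show ?thesis
  proof
    show "?J \<in> borel_measurable M" using J_meas u0 by (rule measurable_F_M)
    show "?J \<omega> = step_integral W \<Phi> b \<omega> - step_integral W \<Phi> a \<omega>" if "q \<omega> \<le> ennreal c" for \<omega>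
    proof -
      have le: "(\<Sum>i<m. v i \<omega>) \<le> c" using that c unfolding q by (simp add: ennreal_le_iff)
      have "\<zeta> i \<omega> = \<eta> i \<omega>" if "i < m" for i
      proof -
        have "(\<Sum>j\<le>i. v j \<omega>) \<le> (\<Sum>j<m. v j \<omega>)" using that v0 by (intro sum_mono2) auto
        then show ?thesis using le by (simp add: \<zeta>_def)
      qed
      then show ?thesis unfolding \<Phi>_eq step_integral_diff[OF ab(2)] u_def[symmetric]
        by (intro sum.cong) (auto simp: \<eta>\<xi>)
    qed
    have [measurable]: "\<zeta> i \<in> borel_measurable M" if "i < m" for i
      using measurable_F_M[OF \<zeta>_meas u0] that .
    have "(\<integral>\<^sup>+\<omega>. ennreal ((?J \<omega>)\<^sup>2) \<partial>M)
      = (\<integral>\<^sup>+\<omega>. (\<Sum>i<m. ennreal ((\<zeta> i \<omega>)\<^sup>2) * ennreal (u (Suc i) - u i)) \<partial>M)"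
      unfolding iso by (rule nn_integral_sum[symmetric]) auto
    also have "\<dots> \<le> (\<integral>\<^sup>+\<omega>. min (ennreal c) (q \<omega>) \<partial>M)"
    proof (intro nn_integral_mono)
      fix \<omega>
      have "(\<Sum>i<m. ennreal ((\<zeta> i \<omega>)\<^sup>2) * ennreal (u (Suc i) - u i))
        = (\<Sum>i<m. ennreal ((\<zeta> i \<omega>)\<^sup>2 * (u (Suc i) - u i)))"
        by (simp add: ennreal_mult')
      also have "\<dots> = ennreal (\<Sum>i<m. (\<zeta> i \<omega>)\<^sup>2 * (u (Suc i) - u i))"
        by (intro sum_ennreal) (use u_Suc in auto)
      also have "\<dots> \<le> ennreal (min c (\<Sum>i<m. v i \<omega>))"
        unfolding \<zeta>v by (intro ennreal_leI sum_stopped_le c v0)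
      also have "\<dots> = min (ennreal c) (q \<omega>)"
        unfolding q by (rule min_of_mono[symmetric]) (simp add: mono_def ennreal_leI)
      finally show "(\<Sum>i<m. ennreal ((\<zeta> i \<omega>)\<^sup>2) * ennreal (u (Suc i) - u i)) \<le> min (ennreal c) (q \<omega>)" .
    qed
    finally show "(\<integral>\<^sup>+\<omega>. ennreal ((?J \<omega>)\<^sup>2) \<partial>M) \<le> (\<integral>\<^sup>+\<omega>. min (ennreal c) (q \<omega>) \<partial>M)" .
  qed
qed

end

section \<open>The localized isometry for Ito integrals\<close>

text \<open>The difference of the two sides is a perfect square divided by \<open>e\<close>. The
  factor of \<open>x\<close> can be taken arbitrarily close to 1, so comparing energies loses no
  constant in the limit.\<close>

lemma power2_le_weighted:
  fixes x y e :: real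
  assumes "0 < e"
  shows "y\<^sup>2 \<le> (1 + e) * x\<^sup>2 + (1 + 1 / e) * (x - y)\<^sup>2"
proof -
  have "(1 + e) * x\<^sup>2 + (1 + 1 / e) * (x - y)\<^sup>2 - y\<^sup>2 = (e * x + (x - y))\<^sup>2 / e"
    using assms by (simp add: power2_eq_square field_simps)
  moreover have "0 \<le> (e * x + (x - y))\<^sup>2 / e" using assms by simp
  ultimately show ?thesis by linarith
qed

text \<open>The hypothesis bounds \<open>q\<close> from above only. The maximum with
  \<open>Q\<close> makes the lower half trivial and turns a limit superior bound into convergence,
  without subtraction in \<open>ennreal\<close>.\<close>

lemma tendsto_max_if_le_weighted:
  fixes q e :: "nat \<Rightarrow> ennreal" and Q :: ennreal
  assumes Q: "Q < \<infinity>" and e: "e \<longlonglongrightarrow> 0"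
    and le: "\<And>k \<epsilon>. 0 < \<epsilon> \<Longrightarrow> q k \<le> ennreal (1 + \<epsilon>) * Q + ennreal (1 + 1 / \<epsilon>) * e k"
  shows "(\<lambda>k. max (q k) Q) \<longlonglongrightarrow> Q"
proof (rule order_tendstoI)
  fix a assume "a < Q"
  then show "\<forall>\<^sub>F k in sequentially. a < max (q k) Q" by (auto simp: less_max_iff_disj)
next
  fix a assume "Q < a"
  then obtain z where z: "Q < z" "z < a" using dense by blast
  obtain r where r: "Q = ennreal r" "0 \<le> r" using Q by (cases Q) auto
  have "z < \<infinity>" using z(2) by (metis infinity_ennreal_def less_top order_less_trans top.not_eq_extremum)
  then obtain s where s: "z = ennreal s" "0 \<le> s" by (cases z) auto
  have rs: "r < s" using z(1) r s by (simp add: ennreal_less_iff)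
  \<comment> \<open>Chosen so that \<open>(1 + \<epsilon>) * r = s - \<epsilon>\<close>; the
    denominator \<open>r + 1\<close> also covers \<open>r = 0\<close>.\<close>
  define \<epsilon> where "\<epsilon> = (s - r) / (r + 1)"
  have \<epsilon>: "0 < \<epsilon>" using rs r by (simp add: \<epsilon>_def)
  have "(1 + \<epsilon>) * r < s"
  proof -
    have "\<epsilon> * (r + 1) = s - r" using r by (simp add: \<epsilon>_def)
    then have "(1 + \<epsilon>) * r = s - \<epsilon>" by (simp add: algebra_simps)
    then show ?thesis using \<epsilon> by linarith
  qed
  then have "ennreal ((1 + \<epsilon>) * r) \<le> z" unfolding s by (intro ennreal_leI) simp
  then have less: "ennreal (1 + \<epsilon>) * Q < a"
    using z(2) \<epsilon> r by (simp add: ennreal_mult)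
  have "(\<lambda>k. ennreal (1 + \<epsilon>) * Q + ennreal (1 + 1 / \<epsilon>) * e k) \<longlonglongrightarrow> ennreal (1 + \<epsilon>) * Q + ennreal (1 + 1 / \<epsilon>) * 0"
    by (intro tendsto_add tendsto_const ennreal_tendsto_cmult e) simp
  then have "\<forall>\<^sub>F k in sequentially. ennreal (1 + \<epsilon>) * Q + ennreal (1 + 1 / \<epsilon>) * e k < a"
    using less by (intro order_tendstoD(2)) auto
  then show "\<forall>\<^sub>F k in sequentially. max (q k) Q < a"
    by eventually_elim (use le[OF \<epsilon>] \<open>Q < a\<close> in \<open>auto intro: order_le_less_trans\<close>)
qed

section \<open>Convergence in probability for \<open>ennreal\<close>-valued sequences\<close>

context prob_space
begin

lemma tendsto_0_in_prob_add:
  fixes Y Z :: "nat \<Rightarrow> 'a \<Rightarrow> ennreal"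
  assumes [measurable]: "\<And>k. Y k \<in> borel_measurable M" "\<And>k. Z k \<in> borel_measurable M"
    and Y: "\<And>\<epsilon>. 0 < \<epsilon> \<Longrightarrow> (\<lambda>k. prob {\<omega> \<in> space M. ennreal \<epsilon> < Y k \<omega>}) \<longlonglongrightarrow> 0"
    and Z: "\<And>\<epsilon>. 0 < \<epsilon> \<Longrightarrow> (\<lambda>k. prob {\<omega> \<in> space M. ennreal \<epsilon> < Z k \<omega>}) \<longlonglongrightarrow> 0"
    and \<epsilon>: "0 < \<epsilon>"
  shows "(\<lambda>k. prob {\<omega> \<in> space M. ennreal \<epsilon> < Y k \<omega> + Z k \<omega>}) \<longlonglongrightarrow> 0"
proof (rule tendsto_sandwich[where f = "\<lambda>_. 0"])
  let ?A = "\<lambda>Y k. {\<omega> \<in> space M. ennreal (\<epsilon> / 2) < Y k \<omega>}"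
  have "prob {\<omega> \<in> space M. ennreal \<epsilon> < Y k \<omega> + Z k \<omega>} \<le> prob (?A Y k) + prob (?A Z k)" for k
  proof -
    have "{\<omega> \<in> space M. ennreal \<epsilon> < Y k \<omega> + Z k \<omega>} \<subseteq> ?A Y k \<union> ?A Z k"
    proof safe
      fix \<omega> assume "ennreal \<epsilon> < Y k \<omega> + Z k \<omega>" "\<not> ennreal (\<epsilon> / 2) < Z k \<omega>"
      show "ennreal (\<epsilon> / 2) < Y k \<omega>"
      proof (rule ccontr)
        assume "\<not> ?thesis"
        then have "Y k \<omega> + Z k \<omega> \<le> ennreal (\<epsilon> / 2) + ennreal (\<epsilon> / 2)"
          using \<open>\<not> ennreal (\<epsilon> / 2) < Z k \<omega>\<close> by (intro add_mono) auto
        also have "\<dots> = ennreal \<epsilon>" using \<epsilon> by (simp add: ennreal_plus[symmetric] del: ennreal_plus)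
        finally show False using \<open>ennreal \<epsilon> < Y k \<omega> + Z k \<omega>\<close> by simp
      qed
    qed
    then have "prob {\<omega> \<in> space M. ennreal \<epsilon> < Y k \<omega> + Z k \<omega>} \<le> prob (?A Y k \<union> ?A Z k)"
      by (intro finite_measure_mono) auto
    also have "\<dots> \<le> prob (?A Y k) + prob (?A Z k)" by (intro measure_Un_le) auto
    finally show ?thesis .
  qed
  then show "\<forall>\<^sub>F k in sequentially. prob {\<omega> \<in> space M. ennreal \<epsilon> < Y k \<omega> + Z k \<omega>} \<le> prob (?A Y k) + prob (?A Z k)"
    by simp
  show "(\<lambda>k. prob (?A Y k) + prob (?A Z k)) \<longlonglongrightarrow> 0"
    using tendsto_add[OF Y[of "\<epsilon> / 2"] Z[of "\<epsilon> / 2"]] \<epsilon> by simp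
qed auto

text \<open>Truncation at 1 makes the sequence real and bounded, so convergence in probability
  becomes convergence in mean, which has an almost surely convergent subsequence. Once the truncated
  values are below 1 they agree with \<open>Z\<close>, so the truncation disappears in the
  limit.\<close>

lemma tendsto_0_in_prob_AE_subseq:
  fixes Z :: "nat \<Rightarrow> 'a \<Rightarrow> ennreal"
  assumes [measurable]: "\<And>k. Z k \<in> borel_measurable M"
    and Z: "\<And>\<epsilon>. 0 < \<epsilon> \<Longrightarrow> (\<lambda>k. prob {\<omega> \<in> space M. ennreal \<epsilon> < Z k \<omega>}) \<longlonglongrightarrow> 0"
  obtains r :: "nat \<Rightarrow> nat" where "strict_mono r" "AE \<omega> in M. (\<lambda>n. Z (r n) \<omega>) \<longlonglongrightarrow> 0"
proof -
  define u where "u k \<omega> = enn2real (min 1 (Z k \<omega>))" for k \<omega>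
  have [measurable]: "u k \<in> borel_measurable M" for k unfolding u_def[abs_def] by measurable
  have u: "0 \<le> u k \<omega>" "u k \<omega> \<le> 1" "ennreal (u k \<omega>) = min 1 (Z k \<omega>)" for k \<omega>
    unfolding u_def by (auto simp: enn2real_leI min_def ennreal_enn2real_if top_unique)
  have int: "integrable M (u k)" for k
    by (rule integrable_const_bound[of _ 1]) (use u in auto)
  have bound: "(\<integral>\<omega>. u k \<omega> \<partial>M) \<le> \<epsilon> + prob {\<omega> \<in> space M. ennreal \<epsilon> < Z k \<omega>}" if "0 < \<epsilon>" for k \<epsilon>
  proof -
    have "(\<integral>\<omega>. u k \<omega> \<partial>M) \<le> (\<integral>\<omega>. \<epsilon> + indicator {\<omega> \<in> space M. ennreal \<epsilon> < Z k \<omega>} \<omega> \<partial>M)"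
    proof (intro integral_mono int)
      show "integrable M (\<lambda>\<omega>. \<epsilon> + indicator {\<omega> \<in> space M. ennreal \<epsilon> < Z k \<omega>} \<omega>)"
        by (intro Bochner_Integration.integrable_add) (auto simp: less_top[symmetric])
      fix \<omega> assume \<omega>: "\<omega> \<in> space M"
      show "u k \<omega> \<le> \<epsilon> + indicator {\<omega> \<in> space M. ennreal \<epsilon> < Z k \<omega>} \<omega>"
      proof (cases "ennreal \<epsilon> < Z k \<omega>")
        case True
        then show ?thesis using \<omega> u(2)[of k \<omega>] that by simp
      next
        case False
        then have "ennreal (u k \<omega>) \<le> ennreal \<epsilon>" unfolding u(3) by (simp add: min.coboundedI2)
        then show ?thesis using that by (simp add: ennreal_le_iff indicator_def)
      qed
    qed
    also have "\<dots> = \<epsilon> + prob {\<omega> \<in> space M. ennreal \<epsilon> < Z k \<omega>}"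
      by (subst Bochner_Integration.integral_add) (auto simp: less_top[symmetric] prob_space)
    finally show ?thesis .
  qed
  have "(\<lambda>k. \<integral>\<omega>. norm (u k \<omega>) \<partial>M) \<longlonglongrightarrow> 0"
  proof (rule LIMSEQ_I)
    fix \<epsilon> :: real assume "0 < \<epsilon>"
    then have "\<forall>\<^sub>F k in sequentially. prob {\<omega> \<in> space M. ennreal (\<epsilon>/2) < Z k \<omega>} < \<epsilon>/2"
      using order_tendstoD(2)[OF Z[of "\<epsilon>/2"], of "\<epsilon>/2"] by simp
    then obtain k0 where k0: "\<And>k. k0 \<le> k \<Longrightarrow> prob {\<omega> \<in> space M. ennreal (\<epsilon>/2) < Z k \<omega>} < \<epsilon>/2"
      unfolding eventually_sequentially by blast
    have "norm ((\<integral>\<omega>. norm (u k \<omega>) \<partial>M) - 0) < \<epsilon>" if "k0 \<le> k" for k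
      using bound[of "\<epsilon>/2" k] k0[OF that] \<open>0 < \<epsilon>\<close> u(1) by simp
    then show "\<exists>k0. \<forall>k\<ge>k0. norm ((\<integral>\<omega>. norm (u k \<omega>) \<partial>M) - 0) < \<epsilon>" by blast
  qed
  from tendsto_L1_AE_subseq[OF int this] obtain r where
    r: "strict_mono r" "AE \<omega> in M. (\<lambda>n. u (r n) \<omega>) \<longlonglongrightarrow> 0" by blast
  have "(\<lambda>n. Z (r n) \<omega>) \<longlonglongrightarrow> 0" if "(\<lambda>n. u (r n) \<omega>) \<longlonglongrightarrow> 0" for \<omega>
  proof -
    have lim: "(\<lambda>n. ennreal (u (r n) \<omega>)) \<longlonglongrightarrow> 0" using tendsto_ennrealI[OF that] by simp
    then have "\<forall>\<^sub>F n in sequentially. ennreal (u (r n) \<omega>) < 1" by (rule order_tendstoD) simp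
    then have "\<forall>\<^sub>F n in sequentially. ennreal (u (r n) \<omega>) = Z (r n) \<omega>"
      by eventually_elim (auto simp: u(3) min_def split: if_splits)
    then show ?thesis using lim by (rule Lim_transform_eventually[rotated])
  qed
  then have "AE \<omega> in M. (\<lambda>n. Z (r n) \<omega>) \<longlonglongrightarrow> 0" using r(2) by auto
  then show ?thesis using r(1) that by blast
qed

end

section \<open>Admissible integrands and their energy\<close>

locale ito_integral = wiener_space +
  fixes T :: real and H I :: "real \<Rightarrow> 'a \<Rightarrow> real"
  assumes ito: "has_ito_integral M F W T H I"
begin

text \<open>The quadratic variation of the Ito integral over \<open>[a, b]\<close>, kept in
  \<open>ennreal\<close> because it is finite only almost surely.\<close>

definition energy :: "real \<Rightarrow> real \<Rightarrow> 'a \<Rightarrow> ennreal" where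
  "energy a b \<omega> = (\<integral>\<^sup>+t\<in>{a..b}. ennreal ((H t \<omega>)\<^sup>2) \<partial>lborel)"

text \<open>Nothing is known about \<open>H\<close> outside \<open>[0,T]\<close>. Cutting it off
  gives a function measurable on the whole product with \<open>lborel\<close>, the form that Fubini
  arguments require.\<close>

lemma measurable_H_cut:
  "(\<lambda>p. H (fst p) (snd p) * indicator {0..T} (fst p)) \<in> borel_measurable (lborel \<Otimes>\<^sub>M M)"
proof -
  let ?\<Omega> = "{0..T} \<times> space M"
  have 1: "(\<lambda>(t, \<omega>). H t \<omega>) \<in> borel_measurable (restrict_space borel {0..T} \<Otimes>\<^sub>M M)"
    using ito unfolding has_ito_integral_def by blast
  have "(\<lambda>p. (fst p, snd p)) \<in> restrict_space (borel \<Otimes>\<^sub>M M) ?\<Omega> \<rightarrow>\<^sub>M restrict_space borel {0..T} \<Otimes>\<^sub>M M"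
  proof (intro measurable_Pair measurable_restrict_space2)
    show "fst \<in> space (restrict_space (borel \<Otimes>\<^sub>M M) ?\<Omega>) \<rightarrow> {0..T}" by (auto simp: space_restrict_space)
    show "fst \<in> borel_measurable (restrict_space (borel \<Otimes>\<^sub>M M) ?\<Omega>)"
      by (intro measurable_restrict_space1) measurable
    show "snd \<in> restrict_space (borel \<Otimes>\<^sub>M M) ?\<Omega> \<rightarrow>\<^sub>M M"
      by (intro measurable_restrict_space1) measurable
  qed
  from measurable_comp[OF this 1]
  have "(\<lambda>p. H (fst p) (snd p)) \<in> borel_measurable (restrict_space (borel \<Otimes>\<^sub>M M) ?\<Omega>)"
    by (simp add: comp_def case_prod_unfold)
  moreover have "?\<Omega> \<inter> space (borel \<Otimes>\<^sub>M M) \<in> sets (borel \<Otimes>\<^sub>M M)" by measurable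
  ultimately have "(\<lambda>p. indicator ?\<Omega> p *\<^sub>R H (fst p) (snd p)) \<in> borel_measurable (borel \<Otimes>\<^sub>M M)"
    by (simp add: borel_measurable_restrict_space_iff)
  then have "(\<lambda>p. H (fst p) (snd p) * indicator {0..T} (fst p)) \<in> borel_measurable (borel \<Otimes>\<^sub>M M)"
    by (rule measurable_cong[THEN iffD1, rotated]) (auto simp: space_pair_measure indicator_def)
  then show ?thesis using sets_lborel by (simp cong: measurable_cong_sets sets_pair_measure_cong)
qed

lemma measurable_energy [measurable]:
  assumes "0 \<le> a" "b \<le> T"
  shows "energy a b \<in> borel_measurable M"
proof -
  note [measurable] = measurable_H_cut
  have "(\<lambda>\<omega>. \<integral>\<^sup>+t. ennreal ((H (fst (t, \<omega>)) (snd (t, \<omega>)) * indicator {0..T} (fst (t, \<omega>)))\<^sup>2) * indicator {a..b} t \<partial>lborel)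
      \<in> borel_measurable M"
    by measurable
  also have "(\<lambda>\<omega>. \<integral>\<^sup>+t. ennreal ((H (fst (t, \<omega>)) (snd (t, \<omega>)) * indicator {0..T} (fst (t, \<omega>)))\<^sup>2) * indicator {a..b} t \<partial>lborel)
      = energy a b"
    unfolding energy_def[abs_def] using assms
    by (intro ext nn_integral_cong) (auto simp: indicator_def)
  finally show ?thesis .
qed

lemma energy_mono: "a' \<le> a \<Longrightarrow> b \<le> b' \<Longrightarrow> energy a b \<omega> \<le> energy a' b' \<omega>"
  unfolding energy_def by (intro nn_integral_mono) (auto simp: indicator_def)

lemma energy_finite: "AE \<omega> in M. energy 0 T \<omega> < \<infinity>"
  using ito unfolding has_ito_integral_def energy_def by blast

lemma measurable_I: "t \<in> {0..T} \<Longrightarrow> I t \<in> borel_measurable M"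
  using ito unfolding has_ito_integral_def by blast

end

text \<open>Fatou's lemma in the form that removes a truncation level without a dominating
  function.\<close>

lemma nn_integral_le_of_AE_tendsto:
  fixes f :: "nat \<Rightarrow> 'a \<Rightarrow> ennreal"
  assumes "\<And>n. f n \<in> borel_measurable M" and lim: "AE x in M. (\<lambda>n. f n x) \<longlonglongrightarrow> g x"
    and le: "\<And>n. (\<integral>\<^sup>+x. f n x \<partial>M) \<le> C"
  shows "(\<integral>\<^sup>+x. g x \<partial>M) \<le> C"
proof -
  have "(\<integral>\<^sup>+x. g x \<partial>M) = (\<integral>\<^sup>+x. liminf (\<lambda>n. f n x) \<partial>M)"
    by (intro nn_integral_cong_AE) (use lim in eventually_elim, simp add: lim_imp_Liminf)
  also have "\<dots> \<le> liminf (\<lambda>n. \<integral>\<^sup>+x. f n x \<partial>M)" by (rule nn_integral_liminf[OF assms(1)])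
  also have "\<dots> \<le> liminf (\<lambda>n. C)" by (intro Liminf_mono always_eventually allI le)
  also have "\<dots> = C" by (simp add: Liminf_const)
  finally show ?thesis .
qed

context wiener_space
begin

lemma step_coefficient_measurable:
  assumes "nonanticipating_step F (m, s, \<xi>)" "i < m"
  shows "\<xi> i \<in> borel_measurable M"
proof -
  have "0 \<le> s i" using step_grid_mono[OF assms(1), of 0 i] assms by auto
  then show ?thesis using assms measurable_F_M by auto
qed

lemma measurable_step_integral:
  assumes "nonanticipating_step F \<Phi>" "0 \<le> t"
  shows "step_integral W \<Phi> t \<in> borel_measurable M"
proof -
  obtain m s \<xi> where \<Phi>: "\<Phi> = (m, s, \<xi>)" by (cases \<Phi>)
  note na = assms(1)[unfolded \<Phi>]
  have "W (min t (s i)) \<in> borel_measurable M" if "i \<le> m" for i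
    using step_grid_mono[OF na, of 0 i] na that assms(2) by (intro measurable_W) auto
  then have "(\<lambda>\<omega>. \<Sum>i<m. \<xi> i \<omega> * (W (min t (s (Suc i))) \<omega> - W (min t (s i)) \<omega>)) \<in> borel_measurable M"
    using step_coefficient_measurable[OF na]
    by (intro borel_measurable_sum borel_measurable_times borel_measurable_diff) auto
  then show ?thesis unfolding \<Phi> by (simp cong: measurable_cong)
qed

lemma measurable_step_value:
  assumes "nonanticipating_step F \<Phi>"
  shows "(\<lambda>p. step_value \<Phi> (fst p) (snd p)) \<in> borel_measurable (lborel \<Otimes>\<^sub>M M)"
proof -
  obtain m s \<xi> where \<Phi>: "\<Phi> = (m, s, \<xi>)" by (cases \<Phi>)
  have "(\<lambda>p. \<xi> i (snd p)) \<in> borel_measurable (lborel \<Otimes>\<^sub>M M)" if "i < m" for i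
    using measurable_comp[OF measurable_snd step_coefficient_measurable[OF assms[unfolded \<Phi>] that]]
    by (simp add: comp_def)
  moreover have "(\<lambda>p. indicator {s i<..s (Suc i)} (fst p) :: real) \<in> borel_measurable (lborel \<Otimes>\<^sub>M M)" for i
    by measurable
  ultimately show ?thesis unfolding \<Phi> step_value.simps
    by (intro borel_measurable_sum borel_measurable_times) auto
qed

end

context ito_integral
begin

lemma measurable_H_section:
  assumes "\<omega> \<in> space M"
  shows "(\<lambda>t. H t \<omega> * indicator {0..T} t) \<in> borel_measurable lborel"
proof -
  have "(\<lambda>t. (t, \<omega>)) \<in> lborel \<rightarrow>\<^sub>M lborel \<Otimes>\<^sub>M M" using assms by measurable
  from measurable_comp[OF this measurable_H_cut] show ?thesis by (simp add: comp_def)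
qed

lemma measurable_step_section:
  assumes "nonanticipating_step F \<Phi>" "\<omega> \<in> space M"
  shows "(\<lambda>t. step_value \<Phi> t \<omega>) \<in> borel_measurable lborel"
proof -
  have "(\<lambda>t. (t, \<omega>)) \<in> lborel \<rightarrow>\<^sub>M lborel \<Otimes>\<^sub>M M" using assms by measurable
  from measurable_comp[OF this measurable_step_value[OF assms(1)]] show ?thesis by (simp add: comp_def)
qed

definition error_energy :: "'a step \<Rightarrow> 'a \<Rightarrow> ennreal" where
  "error_energy \<Phi> \<omega> = (\<integral>\<^sup>+t\<in>{0..T}. ennreal ((H t \<omega> - step_value \<Phi> t \<omega>)\<^sup>2) \<partial>lborel)"

lemma measurable_error_energy:
  assumes "nonanticipating_step F \<Phi>"
  shows "error_energy \<Phi> \<in> borel_measurable M"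
proof -
  note [measurable] = measurable_H_cut measurable_step_value[OF assms]
  have "(\<lambda>\<omega>. \<integral>\<^sup>+t. ennreal ((H (fst (t, \<omega>)) (snd (t, \<omega>)) * indicator {0..T} (fst (t, \<omega>))
      - step_value \<Phi> (fst (t, \<omega>)) (snd (t, \<omega>)))\<^sup>2) * indicator {0..T} t \<partial>lborel) \<in> borel_measurable M"
    by measurable
  also have "(\<lambda>\<omega>. \<integral>\<^sup>+t. ennreal ((H (fst (t, \<omega>)) (snd (t, \<omega>)) * indicator {0..T} (fst (t, \<omega>))
      - step_value \<Phi> (fst (t, \<omega>)) (snd (t, \<omega>)))\<^sup>2) * indicator {0..T} t \<partial>lborel) = error_energy \<Phi>"
    unfolding error_energy_def[abs_def] by (intro ext nn_integral_cong) (auto simp: indicator_def)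
  finally show ?thesis .
qed

text \<open>The approximation error is enlarged from \<open>[a, b]\<close> to \<open>[0,T]\<close>,
  since \<open>error_energy\<close> is the quantity that tends to zero.\<close>

lemma step_energy_le:
  assumes \<Phi>: "nonanticipating_step F \<Phi>" and ab: "0 \<le> a" "b \<le> T" and \<omega>: "\<omega> \<in> space M" and \<epsilon>: "0 < \<epsilon>"
  shows "(\<integral>\<^sup>+t\<in>{a..b}. ennreal ((step_value \<Phi> t \<omega>)\<^sup>2) \<partial>lborel)
    \<le> ennreal (1 + \<epsilon>) * energy a b \<omega> + ennreal (1 + 1 / \<epsilon>) * error_energy \<Phi> \<omega>"
proof -
  let ?H = "\<lambda>t. H t \<omega> * indicator {0..T} t" and ?S = "\<lambda>t. step_value \<Phi> t \<omega>"
  note [measurable] = measurable_H_section[OF \<omega>] measurable_step_section[OF \<Phi> \<omega>]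
  have "(\<integral>\<^sup>+t\<in>{a..b}. ennreal ((?S t)\<^sup>2) \<partial>lborel)
    \<le> (\<integral>\<^sup>+t. ennreal (1 + \<epsilon>) * (ennreal ((?H t)\<^sup>2) * indicator {a..b} t)
          + ennreal (1 + 1 / \<epsilon>) * (ennreal ((?H t - ?S t)\<^sup>2) * indicator {0..T} t) \<partial>lborel)"
  proof (intro nn_integral_mono)
    fix t
    have "ennreal ((?S t)\<^sup>2) \<le> ennreal (1 + \<epsilon>) * ennreal ((?H t)\<^sup>2) + ennreal (1 + 1 / \<epsilon>) * ennreal ((?H t - ?S t)\<^sup>2)"
      using power2_le_weighted[OF \<epsilon>, of "?S t" "?H t"] \<epsilon>
      by (simp add: ennreal_mult[symmetric] ennreal_plus[symmetric] ennreal_leI del: ennreal_plus)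
    then show "ennreal ((?S t)\<^sup>2) * indicator {a..b} t
      \<le> ennreal (1 + \<epsilon>) * (ennreal ((?H t)\<^sup>2) * indicator {a..b} t)
          + ennreal (1 + 1 / \<epsilon>) * (ennreal ((?H t - ?S t)\<^sup>2) * indicator {0..T} t)"
      using ab by (cases "t \<in> {a..b}") auto
  qed
  also have "\<dots> = ennreal (1 + \<epsilon>) * (\<integral>\<^sup>+t. ennreal ((?H t)\<^sup>2) * indicator {a..b} t \<partial>lborel)
          + ennreal (1 + 1 / \<epsilon>) * (\<integral>\<^sup>+t. ennreal ((?H t - ?S t)\<^sup>2) * indicator {0..T} t \<partial>lborel)"
    by (subst nn_integral_add) (auto simp: nn_integral_cmult)
  also have "(\<integral>\<^sup>+t. ennreal ((?H t)\<^sup>2) * indicator {a..b} t \<partial>lborel) = energy a b \<omega>"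
    unfolding energy_def using ab by (intro nn_integral_cong) (auto simp: indicator_def)
  also have "(\<integral>\<^sup>+t. ennreal ((?H t - ?S t)\<^sup>2) * indicator {0..T} t \<partial>lborel) = error_energy \<Phi> \<omega>"
    unfolding error_energy_def by (intro nn_integral_cong) (auto simp: indicator_def)
  finally show ?thesis .
qed

section \<open>Passage from step processes to the Ito integral\<close>

lemma AE_approximating_steps:
  assumes a: "a \<in> {0..T}" and b: "b \<in> {0..T}"
  obtains \<Phi> :: "nat \<Rightarrow> 'a step" where "\<forall>k. nonanticipating_step F (\<Phi> k)"
    "AE \<omega> in M. (\<lambda>k. error_energy (\<Phi> k) \<omega>) \<longlonglongrightarrow> 0"
    "AE \<omega> in M. (\<lambda>k. step_integral W (\<Phi> k) b \<omega> - step_integral W (\<Phi> k) a \<omega>) \<longlonglongrightarrow> I b \<omega> - I a \<omega>"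
proof -
  obtain \<Phi> :: "nat \<Rightarrow> 'a step" where na: "\<And>k. nonanticipating_step F (\<Phi> k)"
    and err: "\<And>\<epsilon>. 0 < \<epsilon> \<Longrightarrow> (\<lambda>k. prob {\<omega> \<in> space M. ennreal \<epsilon> < error_energy (\<Phi> k) \<omega>}) \<longlonglongrightarrow> 0"
    and int: "\<And>t \<epsilon>. t \<in> {0..T} \<Longrightarrow> 0 < \<epsilon> \<Longrightarrow>
       (\<lambda>k. prob {\<omega> \<in> space M. \<epsilon> < \<bar>step_integral W (\<Phi> k) t \<omega> - I t \<omega>\<bar>}) \<longlonglongrightarrow> 0"
    using ito unfolding has_ito_integral_def error_energy_def by blast
  define Y where "Y t k \<omega> = ennreal \<bar>step_integral W (\<Phi> k) t \<omega> - I t \<omega>\<bar>" for t k \<omega>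
  have Y_meas[measurable]: "Y t k \<in> borel_measurable M" if "t \<in> {0..T}" for t k
    using measurable_step_integral[OF na, of t k] measurable_I[OF that] that unfolding Y_def[abs_def] by simp
  have e_meas[measurable]: "error_energy (\<Phi> k) \<in> borel_measurable M" for k
    by (rule measurable_error_energy[OF na])
  have Y: "(\<lambda>k. prob {\<omega> \<in> space M. ennreal \<epsilon> < Y t k \<omega>}) \<longlonglongrightarrow> 0" if "t \<in> {0..T}" "0 < \<epsilon>" for t \<epsilon>
    using int[OF that] that unfolding Y_def by (simp add: ennreal_less_iff)
  \<comment> \<open>The errors at both end points and the energy error must vanish along one common
    subsequence; adding them allows a single extraction.\<close>
  define Z where "Z k \<omega> = (Y a k \<omega> + Y b k \<omega>) + error_energy (\<Phi> k) \<omega>" for k \<omega>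
  have YY_meas: "(\<lambda>\<omega>. Y a k \<omega> + Y b k \<omega>) \<in> borel_measurable M" for k
    using a b by measurable
  have Z_meas: "Z k \<in> borel_measurable M" for k
    unfolding Z_def[abs_def] using YY_meas e_meas by (rule borel_measurable_add)
  have "(\<lambda>k. prob {\<omega> \<in> space M. ennreal \<epsilon> < Z k \<omega>}) \<longlonglongrightarrow> 0" if "0 < \<epsilon>" for \<epsilon>
    unfolding Z_def
  proof (rule tendsto_0_in_prob_add[OF YY_meas e_meas _ err that])
    fix \<delta> :: real assume "0 < \<delta>"
    then show "(\<lambda>k. prob {\<omega> \<in> space M. ennreal \<delta> < Y a k \<omega> + Y b k \<omega>}) \<longlonglongrightarrow> 0"
      using a b by (intro tendsto_0_in_prob_add Y Y_meas)
  qed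
  from tendsto_0_in_prob_AE_subseq[OF Z_meas this] obtain r :: "nat \<Rightarrow> nat"
    where r: "AE \<omega> in M. (\<lambda>n. Z (r n) \<omega>) \<longlonglongrightarrow> 0" by blast
  have "(\<lambda>k. error_energy (\<Phi> (r k)) \<omega>) \<longlonglongrightarrow> 0 \<and>
     (\<lambda>k. step_integral W (\<Phi> (r k)) b \<omega> - step_integral W (\<Phi> (r k)) a \<omega>) \<longlonglongrightarrow> I b \<omega> - I a \<omega>"
    if Z: "(\<lambda>n. Z (r n) \<omega>) \<longlonglongrightarrow> 0" for \<omega>
  proof -
    have le: "Y a k \<omega> \<le> Z k \<omega>" "Y b k \<omega> \<le> Z k \<omega>" "error_energy (\<Phi> k) \<omega> \<le> Z k \<omega>" for k
      unfolding Z_def by (simp_all add: add_increasing add_increasing2)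
    have to0: "(\<lambda>n. f (r n)) \<longlonglongrightarrow> 0" if "\<And>k. f k \<le> Z k \<omega>" for f :: "nat \<Rightarrow> ennreal"
      by (rule tendsto_sandwich[OF _ _ tendsto_const Z]) (use that in auto)
    have real: "(\<lambda>n. step_integral W (\<Phi> (r n)) t \<omega>) \<longlonglongrightarrow> I t \<omega>" if "\<And>k. Y t k \<omega> \<le> Z k \<omega>" for t
    proof -
      have "(\<lambda>n. ennreal \<bar>step_integral W (\<Phi> (r n)) t \<omega> - I t \<omega>\<bar>) \<longlonglongrightarrow> ennreal 0"
        using to0[OF that] unfolding Y_def by simp
      then have "(\<lambda>n. \<bar>step_integral W (\<Phi> (r n)) t \<omega> - I t \<omega>\<bar>) \<longlonglongrightarrow> 0"
        by (rule tendsto_ennrealD) auto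
      then show ?thesis using LIM_zero_iff[of "\<lambda>n. step_integral W (\<Phi> (r n)) t \<omega>"] tendsto_rabs_zero_iff by blast
    qed
    show ?thesis using to0[OF le(3)] tendsto_diff[OF real[OF le(2)] real[OF le(1)]] by blast
  qed
  with r have "AE \<omega> in M. (\<lambda>k. error_energy (\<Phi> (r k)) \<omega>) \<longlonglongrightarrow> 0"
    "AE \<omega> in M. (\<lambda>k. step_integral W (\<Phi> (r k)) b \<omega> - step_integral W (\<Phi> (r k)) a \<omega>) \<longlonglongrightarrow> I b \<omega> - I a \<omega>"
    by auto
  then show ?thesis using that[of "\<lambda>k. \<Phi> (r k)"] na by blast
qed

text \<open>The strict inequality \<open>energy a b < c\<close> passes to the approximations: on
  this event the step energies are eventually at most \<open>c\<close>, so the truncated integrals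
  \<open>J k\<close> eventually coincide with the step integrals and converge to the increment of
  \<open>I\<close>. The left side then follows by Fatou and the right side by dominated
  convergence.\<close>

lemma ito_localized_isometry:
  assumes ab: "0 \<le> a" "a \<le> b" "b \<le> T" and c: "0 \<le> c"
  shows "(\<integral>\<^sup>+\<omega>. ennreal ((I b \<omega> - I a \<omega>)\<^sup>2) * indicator {\<omega>. energy a b \<omega> < ennreal c} \<omega> \<partial>M)
    \<le> (\<integral>\<^sup>+\<omega>. min (ennreal c) (energy a b \<omega>) \<partial>M)"
proof -
  have "a \<in> {0..T}" "b \<in> {0..T}" using ab by auto
  then obtain \<Phi> :: "nat \<Rightarrow> 'a step" where "\<forall>k. nonanticipating_step F (\<Phi> k)"
    and err: "AE \<omega> in M. (\<lambda>k. error_energy (\<Phi> k) \<omega>) \<longlonglongrightarrow> 0"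
    and conv: "AE \<omega> in M. (\<lambda>k. step_integral W (\<Phi> k) b \<omega> - step_integral W (\<Phi> k) a \<omega>) \<longlonglongrightarrow> I b \<omega> - I a \<omega>"
    by (rule AE_approximating_steps)
  then have na: "nonanticipating_step F (\<Phi> k)" for k by blast
  define q where "q k \<omega> = (\<integral>\<^sup>+t\<in>{a..b}. ennreal ((step_value (\<Phi> k) t \<omega>)\<^sup>2) \<partial>lborel)" for k \<omega>
  have "\<exists>J. J \<in> borel_measurable M \<and>
     (\<forall>\<omega>. q k \<omega> \<le> ennreal c \<longrightarrow> J \<omega> = step_integral W (\<Phi> k) b \<omega> - step_integral W (\<Phi> k) a \<omega>) \<and>
     (\<integral>\<^sup>+\<omega>. ennreal ((J \<omega>)\<^sup>2) \<partial>M) \<le> (\<integral>\<^sup>+\<omega>. min (ennreal c) (q k \<omega>) \<partial>M)" for k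
    by (rule step_integral_truncation[OF na[of k] ab(1,2) c, folded q_def]) blast
  then obtain J where J_meas[measurable]: "\<And>k. J k \<in> borel_measurable M"
    and J_eq: "\<And>k \<omega>. q k \<omega> \<le> ennreal c \<Longrightarrow> J k \<omega> = step_integral W (\<Phi> k) b \<omega> - step_integral W (\<Phi> k) a \<omega>"
    and J_le: "\<And>k. (\<integral>\<^sup>+\<omega>. ennreal ((J k \<omega>)\<^sup>2) \<partial>M) \<le> (\<integral>\<^sup>+\<omega>. min (ennreal c) (q k \<omega>) \<partial>M)"
    by metis
  have [measurable]: "energy a b \<in> borel_measurable M" using ab by measurable
  have q_meas[measurable]: "q k \<in> borel_measurable M" for k
  proof -
    note [measurable] = measurable_step_value[OF na]
    have "(\<lambda>\<omega>. \<integral>\<^sup>+t. ennreal ((step_value (\<Phi> k) (fst (t, \<omega>)) (snd (t, \<omega>)))\<^sup>2) * indicator {a..b} t \<partial>lborel)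
      \<in> borel_measurable M" by measurable
    then show ?thesis unfolding q_def[abs_def] by simp
  qed
  have fin: "AE \<omega> in M. energy a b \<omega> < \<infinity>"
    using energy_finite
  proof eventually_elim
    case (elim \<omega>)
    then show ?case using energy_mono[of 0 a b T \<omega>] ab by (auto intro: order_le_less_trans)
  qed
  have q_lim: "AE \<omega> in M. (\<lambda>k. max (q k \<omega>) (energy a b \<omega>)) \<longlonglongrightarrow> energy a b \<omega>"
    using err fin AE_space
  proof eventually_elim
    case (elim \<omega>)
    show ?case
      by (rule tendsto_max_if_le_weighted[OF elim(2,1)])
        (use step_energy_le[OF na ab(1,3) elim(3)] in \<open>simp add: q_def\<close>)
  qed
  have "AE \<omega> in M. ennreal ((I b \<omega> - I a \<omega>)\<^sup>2) * indicator {\<omega>. energy a b \<omega> < ennreal c} \<omega>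
      \<le> liminf (\<lambda>k. ennreal ((J k \<omega>)\<^sup>2))"
    using conv q_lim
  proof eventually_elim
    case (elim \<omega>)
    show ?case
    proof (cases "energy a b \<omega> < ennreal c")
      case True
      then have "\<forall>\<^sub>F k in sequentially. max (q k \<omega>) (energy a b \<omega>) < ennreal c"
        using order_tendstoD(2)[OF elim(2)] by blast
      then have "\<forall>\<^sub>F k in sequentially. step_integral W (\<Phi> k) b \<omega> - step_integral W (\<Phi> k) a \<omega> = J k \<omega>"
        by eventually_elim (intro J_eq[symmetric], simp add: less_imp_le)
      then have "(\<lambda>k. J k \<omega>) \<longlonglongrightarrow> I b \<omega> - I a \<omega>"
        using elim(1) by (rule Lim_transform_eventually[rotated])
      then have "(\<lambda>k. ennreal ((J k \<omega>)\<^sup>2)) \<longlonglongrightarrow> ennreal ((I b \<omega> - I a \<omega>)\<^sup>2)"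
        by (intro tendsto_ennrealI tendsto_power)
      then have "liminf (\<lambda>k. ennreal ((J k \<omega>)\<^sup>2)) = ennreal ((I b \<omega> - I a \<omega>)\<^sup>2)"
        by (intro lim_imp_Liminf) auto
      then show ?thesis using True by simp
    qed simp
  qed
  then have "(\<integral>\<^sup>+\<omega>. ennreal ((I b \<omega> - I a \<omega>)\<^sup>2) * indicator {\<omega>. energy a b \<omega> < ennreal c} \<omega> \<partial>M)
      \<le> (\<integral>\<^sup>+\<omega>. liminf (\<lambda>k. ennreal ((J k \<omega>)\<^sup>2)) \<partial>M)"
    by (rule nn_integral_mono_AE)
  also have "\<dots> \<le> liminf (\<lambda>k. \<integral>\<^sup>+\<omega>. ennreal ((J k \<omega>)\<^sup>2) \<partial>M)"
    by (rule nn_integral_liminf) measurable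
  \<comment> \<open>Passing to the maximum only enlarges the bound and gives integrands that
    converge, dominated by the constant \<open>c\<close>.\<close>
  also have "\<dots> \<le> liminf (\<lambda>k. \<integral>\<^sup>+\<omega>. min (ennreal c) (max (q k \<omega>) (energy a b \<omega>)) \<partial>M)"
  proof (intro Liminf_mono always_eventually allI)
    fix k
    have "(\<integral>\<^sup>+\<omega>. min (ennreal c) (q k \<omega>) \<partial>M) \<le> (\<integral>\<^sup>+\<omega>. min (ennreal c) (max (q k \<omega>) (energy a b \<omega>)) \<partial>M)"
      by (intro nn_integral_mono min.mono) auto
    then show "(\<integral>\<^sup>+\<omega>. ennreal ((J k \<omega>)\<^sup>2) \<partial>M) \<le> (\<integral>\<^sup>+\<omega>. min (ennreal c) (max (q k \<omega>) (energy a b \<omega>)) \<partial>M)"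
      using J_le[of k] by (rule order_trans[rotated])
  qed
  also have "\<dots> = (\<integral>\<^sup>+\<omega>. min (ennreal c) (energy a b \<omega>) \<partial>M)"
  proof (rule lim_imp_Liminf)
    show "(\<lambda>k. \<integral>\<^sup>+\<omega>. min (ennreal c) (max (q k \<omega>) (energy a b \<omega>)) \<partial>M)
        \<longlonglongrightarrow> (\<integral>\<^sup>+\<omega>. min (ennreal c) (energy a b \<omega>) \<partial>M)"
    proof (rule nn_integral_dominated_convergence[where w = "\<lambda>_. ennreal c"])
      show "AE \<omega> in M. (\<lambda>k. min (ennreal c) (max (q k \<omega>) (energy a b \<omega>))) \<longlonglongrightarrow> min (ennreal c) (energy a b \<omega>)"
        using q_lim by eventually_elim (intro tendsto_min tendsto_const)
    qed (use c in \<open>auto simp: emeasure_space_1\<close>)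
  qed simp
  finally show ?thesis .
qed

text \<open>The level tends to infinity; the energy is almost surely finite, so the indicators are
  eventually 1. An infinite right side is allowed.\<close>

lemma ito_isometry_le:
  assumes ab: "0 \<le> a" "a \<le> b" "b \<le> T"
  shows "(\<integral>\<^sup>+\<omega>. ennreal ((I b \<omega> - I a \<omega>)\<^sup>2) \<partial>M) \<le> (\<integral>\<^sup>+\<omega>. energy a b \<omega> \<partial>M)"
proof -
  have [measurable]: "energy a b \<in> borel_measurable M" "I a \<in> borel_measurable M" "I b \<in> borel_measurable M"
    using ab measurable_I by auto
  let ?f = "\<lambda>n \<omega>. ennreal ((I b \<omega> - I a \<omega>)\<^sup>2) * indicator {\<omega>. energy a b \<omega> < ennreal (real n)} \<omega>"
  have lim: "AE \<omega> in M. (\<lambda>n. ?f n \<omega>) \<longlonglongrightarrow> ennreal ((I b \<omega> - I a \<omega>)\<^sup>2)"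
    using energy_finite
  proof eventually_elim
    case (elim \<omega>)
    then have "energy a b \<omega> < \<infinity>" using energy_mono[of 0 a b T \<omega>] ab by (auto intro: order_le_less_trans)
    then obtain r where r: "energy a b \<omega> = ennreal r" "0 \<le> r" by (cases "energy a b \<omega>") auto
    obtain n0 where "r < real n0" using reals_Archimedean2 by blast
    then have "?f n \<omega> = ennreal ((I b \<omega> - I a \<omega>)\<^sup>2)" if "n0 \<le> n" for n
      using that r by (simp add: ennreal_less_iff)
    then show ?case
      by (intro tendsto_eventually) (auto simp: eventually_sequentially)
  qed
  have "(\<integral>\<^sup>+\<omega>. ?f n \<omega> \<partial>M) \<le> (\<integral>\<^sup>+\<omega>. energy a b \<omega> \<partial>M)" for n
  proof -
    have "(\<integral>\<^sup>+\<omega>. ?f n \<omega> \<partial>M) \<le> (\<integral>\<^sup>+\<omega>. min (ennreal (real n)) (energy a b \<omega>) \<partial>M)"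
      by (rule ito_localized_isometry[OF ab]) simp
    also have "\<dots> \<le> (\<integral>\<^sup>+\<omega>. energy a b \<omega> \<partial>M)" by (intro nn_integral_mono) simp
    finally show ?thesis .
  qed
  then show ?thesis by (intro nn_integral_le_of_AE_tendsto[OF _ lim]) measurable
qed

end

section \<open>Pathwise estimates and a Gronwall inequality\<close>

text \<open>Cauchy-Schwarz against the indicator of \<open>[a, b]\<close>, whose square integral is
  the factor \<open>b - a\<close>.\<close>

lemma set_integral_diff_power2_le:
  fixes x :: "real \<Rightarrow> real"
  assumes cont: "continuous_on {0..T} x" and ab: "0 \<le> a" "a \<le> b" "b \<le> T"
  shows "ennreal (((LBINT s:{0..b}. x s) - (LBINT s:{0..a}. x s))\<^sup>2)
    \<le> ennreal (b - a) * (\<integral>\<^sup>+s\<in>{a..b}. ennreal ((x s)\<^sup>2) \<partial>lborel)"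
proof -
  let ?y = "\<lambda>s. indicator {0..T} s *\<^sub>R x s"
  have [measurable]: "?y \<in> borel_measurable borel"
    using cont by (intro borel_measurable_continuous_on_indicator) auto
  have int: "integrable lborel (\<lambda>s. indicator {0..u} s *\<^sub>R x s)" if "u \<le> T" for u
    using borel_integrable_atLeastAtMost'[of 0 u x] continuous_on_subset[OF cont, of "{0..u}"] that
    by (simp add: set_integrable_def)
  let ?D = "(LBINT s:{0..b}. x s) - (LBINT s:{0..a}. x s)"
  have "?D = (LBINT s. indicator {0..b} s *\<^sub>R x s - indicator {0..a} s *\<^sub>R x s)"
    unfolding set_lebesgue_integral_def using ab by (intro Bochner_Integration.integral_diff[symmetric] int) auto
  then have "ennreal \<bar>?D\<bar> \<le> (\<integral>\<^sup>+s. norm (indicator {0..b} s *\<^sub>R x s - indicator {0..a} s *\<^sub>R x s) \<partial>lborel)"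
    using integral_norm_bound_ennreal[OF Bochner_Integration.integrable_diff[OF int[of b] int[of a]]] ab by simp
  also have "\<dots> \<le> (\<integral>\<^sup>+s. indicator {a..b} s * (ennreal \<bar>?y s\<bar> * indicator {a..b} s) \<partial>lborel)"
    using ab by (intro nn_integral_mono) (auto simp: indicator_def)
  finally have "(ennreal \<bar>?D\<bar>)\<^sup>2 \<le> (\<integral>\<^sup>+s. indicator {a..b} s * (ennreal \<bar>?y s\<bar> * indicator {a..b} s) \<partial>lborel)\<^sup>2"
    by (intro power_mono) auto
  also have "\<dots> \<le> (\<integral>\<^sup>+s. (indicator {a..b} s)\<^sup>2 \<partial>lborel) * (\<integral>\<^sup>+s. (ennreal \<bar>?y s\<bar> * indicator {a..b} s)\<^sup>2 \<partial>lborel)"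
    by (intro Cauchy_Schwarz_nn_integral) measurable
  also have "(\<integral>\<^sup>+s. (indicator {a..b} s)\<^sup>2 \<partial>lborel) = (\<integral>\<^sup>+s. indicator {a..b} s \<partial>lborel)"
    by (intro nn_integral_cong) (auto simp: indicator_def)
  also have "\<dots> = ennreal (b - a)" using ab by simp
  also have "(\<integral>\<^sup>+s. (ennreal \<bar>?y s\<bar> * indicator {a..b} s)\<^sup>2 \<partial>lborel) = (\<integral>\<^sup>+s\<in>{a..b}. ennreal ((x s)\<^sup>2) \<partial>lborel)"
    using ab by (intro nn_integral_cong) (auto simp: indicator_def ennreal_power)
  finally show ?thesis by (simp add: ennreal_power)
qed

text \<open>The energy \<open>E\<close> is continuous in its upper limit, because \<open>x\<close>
  is bounded on \<open>[0,T]\<close>. Hence it cannot jump over \<open>c\<close>: if the level is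
  reached before \<open>t\<close>, then the energy collected while \<open>E < c\<close> is already
  at least \<open>c\<close>.\<close>

lemma min_energy_le_stopped_energy:
  fixes x :: "real \<Rightarrow> real" and c :: real
  assumes cont: "continuous_on {0..T} x" and t: "0 \<le> t" "t \<le> T" and c: "0 < c"
  defines "E \<equiv> \<lambda>s. \<integral>\<^sup>+u\<in>{0..s}. ennreal ((x u)\<^sup>2) \<partial>lborel"
  shows "min (ennreal c) (E t) \<le> (\<integral>\<^sup>+s\<in>{0..t}. (ennreal ((x s)\<^sup>2) * indicator {s. E s < ennreal c} s) \<partial>lborel)"
proof -
  let ?y = "\<lambda>s. indicator {0..T} s *\<^sub>R x s"
  have [measurable]: "?y \<in> borel_measurable borel"
    using cont by (intro borel_measurable_continuous_on_indicator) auto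
  have "bounded (x ` {0..T})" using cont by (intro compact_imp_bounded compact_continuous_image) auto
  then obtain R where "\<forall>y\<in>x ` {0..T}. norm y \<le> R" unfolding bounded_iff by blast
  then have "(x u)\<^sup>2 \<le> R\<^sup>2" if "u \<in> {0..T}" for u
    using that by (intro abs_le_square_iff[THEN iffD1]) force
  then have R: "ennreal ((x u)\<^sup>2) \<le> ennreal (R\<^sup>2)" if "u \<in> {0..T}" for u
    using that by (intro ennreal_leI)
  have E_mono: "E s \<le> E s'" if "s \<le> s'" for s s'
    unfolding E_def using that by (intro nn_integral_mono) (auto simp: indicator_def)
  \<comment> \<open>Lipschitz continuity of \<open>E\<close>, written additively to avoid
    subtraction in \<open>ennreal\<close>.\<close>
  have E_le: "E s \<le> E r + ennreal (R\<^sup>2 * (s - r))" if "0 \<le> r" "r \<le> s" "s \<le> T" for r s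
  proof -
    have "E s \<le> (\<integral>\<^sup>+u. ennreal ((?y u)\<^sup>2) * indicator {0..r} u + ennreal (R\<^sup>2) * indicator {r..s} u \<partial>lborel)"
      unfolding E_def using that R by (intro nn_integral_mono) (auto simp: indicator_def)
    also have "\<dots> = (\<integral>\<^sup>+u. ennreal ((?y u)\<^sup>2) * indicator {0..r} u \<partial>lborel) + (\<integral>\<^sup>+u. ennreal (R\<^sup>2) * indicator {r..s} u \<partial>lborel)"
      by (intro nn_integral_add) measurable
    also have "(\<integral>\<^sup>+u. ennreal ((?y u)\<^sup>2) * indicator {0..r} u \<partial>lborel) = E r"
      unfolding E_def using that by (intro nn_integral_cong) (auto simp: indicator_def)
    also have "(\<integral>\<^sup>+u. ennreal (R\<^sup>2) * indicator {r..s} u \<partial>lborel) = ennreal (R\<^sup>2 * (s - r))"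
      using that by (simp add: nn_integral_cmult_indicator ennreal_mult')
    finally show ?thesis .
  qed
  define S where "S = {s \<in> {0..t}. E s < ennreal c}"
  have "E 0 = 0" unfolding E_def by (simp add: nn_integral_null_set)
  then have "0 \<in> S" using t c by (simp add: S_def)
  then have S: "S \<noteq> {}" "bdd_above S" unfolding S_def by (auto intro!: bdd_aboveI[of _ t])
  have S_le: "s \<le> Sup S" if "s \<in> S" for s using that S(2) by (rule cSup_upper)
  have Sup_le: "Sup S \<le> t" by (rule cSup_least[OF S(1)]) (simp add: S_def)
  define \<tau> where "\<tau> = Sup S"
  have \<tau>: "0 \<le> \<tau>" "\<tau> \<le> t"
    unfolding \<tau>_def using S_le[OF \<open>0 \<in> S\<close>] Sup_le by fast+
  have below: "E s < ennreal c" if s: "s < \<tau>" for s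
  proof -
    obtain s' where "s' \<in> S" "s < s'" using less_cSupE[OF s[unfolded \<tau>_def] S(1)] by blast
    then have "E s \<le> E s'" "E s' < ennreal c" using E_mono[of s s'] by (simp_all add: S_def)
    then show ?thesis by (rule order_le_less_trans)
  qed
  have "min (ennreal c) (E t) \<le> E \<tau>"
  proof (cases "\<tau> = t")
    case False
    then have "\<tau> < t" using \<tau> by simp
    have "ennreal c \<le> E \<tau>"
    proof (rule ennreal_le_epsilon)
      fix e :: real assume "0 < e"
      \<comment> \<open>A point beyond \<open>\<tau>\<close>, so \<open>E s\<close> has reached
        \<open>c\<close>, and close enough that the Lipschitz bound costs at most \<open>e\<close>;
        adding 1 avoids division by zero when \<open>R = 0\<close>.\<close>
      define s where "s = min t (\<tau> + e / (R\<^sup>2 + 1))"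
      have R1: "0 < R\<^sup>2 + 1" by (simp add: add_nonneg_pos)
      then have s: "\<tau> < s" "s \<le> t" "s - \<tau> \<le> e / (R\<^sup>2 + 1)" using \<open>\<tau> < t\<close> \<open>0 < e\<close> unfolding s_def by auto
      have "s \<notin> S" using s(1) S_le[of s] unfolding \<tau>_def by fastforce
      then have "ennreal c \<le> E s" using s \<tau> unfolding S_def by auto
      also have "E s \<le> E \<tau> + ennreal (R\<^sup>2 * (s - \<tau>))" using s \<tau> t by (intro E_le) auto
      finally have "ennreal c \<le> E \<tau> + ennreal (R\<^sup>2 * (s - \<tau>))" .
      moreover have "R\<^sup>2 * (s - \<tau>) \<le> e"
      proof -
        have "R\<^sup>2 * (s - \<tau>) \<le> (R\<^sup>2 + 1) * (e / (R\<^sup>2 + 1))"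
          using s R1 by (intro mult_mono) auto
        also have "\<dots> = e" using R1 by simp
        finally show ?thesis .
      qed
      ultimately show "ennreal c \<le> E \<tau> + ennreal e"
        using order_trans add_left_mono[OF ennreal_leI] by blast
    qed
    then show ?thesis by (rule min.coboundedI1)
  qed simp
  also have "E \<tau> = (\<integral>\<^sup>+s\<in>{0..\<tau>}. ennreal ((x s)\<^sup>2) \<partial>lborel)" by (simp only: E_def)
  also have "\<dots> \<le> (\<integral>\<^sup>+s\<in>{0..t}. (ennreal ((x s)\<^sup>2) * indicator {s. E s < ennreal c} s) \<partial>lborel)"
  proof (rule nn_integral_mono_AE)
    \<comment> \<open>At \<open>\<tau>\<close> itself the energy may equal \<open>c\<close>, so the
      indicator may vanish there; a single point does not affect the integral.\<close>
    have "AE s in lborel. s \<noteq> \<tau>" by (rule AE_lborel_singleton)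
    then show "AE s in lborel. ennreal ((x s)\<^sup>2) * indicator {0..\<tau>} s
      \<le> ennreal ((x s)\<^sup>2) * indicator {s. E s < ennreal c} s * indicator {0..t} s"
      by eventually_elim (use \<tau> below in \<open>auto simp: indicator_def\<close>)
  qed
  finally show ?thesis .
qed

text \<open>The proof compares \<open>h\<close> with the least \<open>K\<close> such that \<open>h t \<le> K exp (\<rho> t)\<close> for a rate
  \<open>\<rho>\<close> large enough to absorb half of \<open>K\<close>.\<close>

lemma gronwall_nn_integral:
  fixes h :: "real \<Rightarrow> ennreal" and a B T c :: real
  assumes T: "0 \<le> T" and a: "0 \<le> a" and B: "0 \<le> B" and c: "0 \<le> c"
    and bound: "\<And>t. t \<in> {0..T} \<Longrightarrow> h t \<le> ennreal c"
    and ineq: "\<And>t. t \<in> {0..T} \<Longrightarrow> h t \<le> (\<integral>\<^sup>+s\<in>{0..t}. (ennreal a + ennreal B * h s) \<partial>lborel)"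
    and t: "t \<in> {0..T}"
  shows "h t \<le> ennreal (2 * a * T * exp ((2 * B + 1) * t))"
proof -
  \<comment> \<open>Twice \<open>B\<close> makes \<open>B / \<rho> \<le> 1 / 2\<close>; the added 1
    keeps the rate positive when \<open>B = 0\<close>.\<close>
  define \<rho> where "\<rho> = 2 * B + 1"
  have \<rho>: "0 < \<rho>" "B / \<rho> \<le> 1 / 2" using B unfolding \<rho>_def by (auto simp: field_simps)
  define k where "k s = enn2real (h s)" for s
  have hk: "h s = ennreal (k s)" if "s \<in> {0..T}" for s
  proof -
    have "h s < top" using order_le_less_trans[OF bound[OF that] ennreal_less_top] .
    then show ?thesis by (simp add: k_def)
  qed
  have k0: "0 \<le> k s" for s by (simp add: k_def)
  have kc: "k s \<le> c" if "s \<in> {0..T}" for s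
    using bound[OF that] c unfolding hk[OF that] by (simp add: ennreal_le_iff)
  define w where "w s = exp (- \<rho> * s) * k s" for s
  \<comment> \<open>The a priori bound \<open>c\<close> makes this supremum finite; it does not
    enter the final estimate.\<close>
  define K where "K = (SUP s\<in>{0..T}. w s)"
  have w_le: "w s \<le> c" if "s \<in> {0..T}" for s
  proof -
    have "w s \<le> 1 * c" unfolding w_def using that \<rho> kc k0 by (intro mult_mono) auto
    then show ?thesis by simp
  qed
  then have bdd: "bdd_above (w ` {0..T})" by (auto intro!: bdd_aboveI[of _ c])
  have wK: "w s \<le> K" if "s \<in> {0..T}" for s unfolding K_def using that bdd by (intro cSUP_upper)
  have kK: "k s \<le> K * exp (\<rho> * s)" if "s \<in> {0..T}" for s
  proof -
    have "k s = w s * exp (\<rho> * s)" by (simp add: w_def exp_minus)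
    then show ?thesis using wK[OF that] by simp
  qed
  have K0: "0 \<le> K" using wK[OF t] k0[of t] unfolding w_def by (smt (verit) exp_ge_zero mult_nonneg_nonneg)
  \<comment> \<open>Inserting the bound with constant \<open>K\<close> into the integral inequality
    returns it with \<open>a * T + K / 2\<close>. Since \<open>K\<close> is a finite supremum,
    \<open>K \<le> 2 * a * T\<close> follows.\<close>
  have "w s \<le> a * T + K / 2" if s: "s \<in> {0..T}" for s
  proof -
    have "h s \<le> (\<integral>\<^sup>+r. ennreal (a + B * (K * exp (\<rho> * r))) * indicator {0..s} r \<partial>lborel)"
    proof (rule order_trans[OF ineq[OF s]], intro nn_integral_mono)
      fix r
      show "(ennreal a + ennreal B * h r) * indicator {0..s} r \<le> ennreal (a + B * (K * exp (\<rho> * r))) * indicator {0..s} r"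
      proof (cases "r \<in> {0..s}")
        case True
        then have r: "r \<in> {0..T}" using s by auto
        have "ennreal a + ennreal B * h r = ennreal (a + B * k r)"
          unfolding hk[OF r] using a B k0 by (simp add: ennreal_mult ennreal_plus)
        also have "\<dots> \<le> ennreal (a + B * (K * exp (\<rho> * r)))"
          using kK[OF r] B by (intro ennreal_leI add_left_mono mult_left_mono)
        finally show ?thesis using True by simp
      qed simp
    qed
    also have "\<dots> = ennreal ((a * s + B * K * exp (\<rho> * s) / \<rho>) - (a * 0 + B * K * exp (\<rho> * 0) / \<rho>))"
    proof (rule nn_integral_FTC_Icc)
      fix r
      show "((\<lambda>s. a * s + B * K * exp (\<rho> * s) / \<rho>) has_real_derivative a + B * (K * exp (\<rho> * r))) (at r)"
        using \<rho> by (auto intro!: derivative_eq_intros)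
      show "0 \<le> a + B * (K * exp (\<rho> * r))" using a B K0 by simp
    qed (use s in auto)
    finally have "ennreal (k s) \<le> ennreal (a * s + B * K * exp (\<rho> * s) / \<rho> - B * K / \<rho>)"
      unfolding hk[OF s] by simp
    moreover have "B * K / \<rho> * 1 \<le> B * K / \<rho> * exp (\<rho> * s)"
      using \<rho> B K0 s by (intro mult_left_mono) auto
    then have "0 \<le> a * s + B * K * exp (\<rho> * s) / \<rho> - B * K / \<rho>"
      using a s by (simp add: add_increasing)
    ultimately have "k s \<le> a * s + B * K * exp (\<rho> * s) / \<rho> - B * K / \<rho>"
      by (simp only: ennreal_le_iff)
    also have "\<dots> \<le> a * T + B / \<rho> * K * exp (\<rho> * s)"
    proof -
      have "a * s \<le> a * T" "0 \<le> B * K / \<rho>" using s a B K0 \<rho> by (auto intro: mult_left_mono)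
      then show ?thesis by (simp add: mult_ac)
    qed
    also have "\<dots> \<le> a * T * exp (\<rho> * s) + 1 / 2 * K * exp (\<rho> * s)"
    proof (rule add_mono)
      have "1 \<le> exp (\<rho> * s)" using s \<rho> by simp
      then show "a * T \<le> a * T * exp (\<rho> * s)"
        using mult_left_mono[of 1 "exp (\<rho> * s)" "a * T"] a T by simp
      show "B / \<rho> * K * exp (\<rho> * s) \<le> 1 / 2 * K * exp (\<rho> * s)"
        using \<rho>(2) K0 by (intro mult_right_mono) auto
    qed
    finally have "k s \<le> (a * T + K / 2) * exp (\<rho> * s)" by (simp add: algebra_simps)
    then have "exp (- \<rho> * s) * k s \<le> exp (- \<rho> * s) * ((a * T + K / 2) * exp (\<rho> * s))"
      by (intro mult_left_mono) auto
    also have "\<dots> = a * T + K / 2" by (simp add: exp_minus)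
    finally show ?thesis unfolding w_def .
  qed
  then have "K \<le> a * T + K / 2" unfolding K_def using t by (intro cSUP_least) auto
  then have "K \<le> 2 * a * T" by simp
  have "k t \<le> K * exp (\<rho> * t)" by (rule kK[OF t])
  also have "\<dots> \<le> 2 * a * T * exp (\<rho> * t)" using \<open>K \<le> 2 * a * T\<close> by (intro mult_right_mono) auto
  finally show ?thesis unfolding hk[OF t] \<rho>_def by (rule ennreal_leI)
qed

section \<open>Moments of the solution\<close>

lemma power2_add_le: "(a + b)\<^sup>2 \<le> 2 * a\<^sup>2 + 2 * b\<^sup>2" for a b :: real
  using zero_le_power2[of "a - b"] by (simp add: power2_eq_square algebra_simps)

section \<open>Expected energies by Fubini\<close>

context ito_integral
begin

text \<open>Fubini needs the event \<open>energy 0 s \<omega> < c\<close> to be measurable in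
  \<open>s\<close> and \<open>\<omega>\<close> jointly, so the energy is obtained as a partial
  integral over a triple product.\<close>

lemma measurable_energy_joint:
  "(\<lambda>p. \<integral>\<^sup>+u\<in>{0..fst p}. ennreal ((H u (snd p) * indicator {0..T} u)\<^sup>2) \<partial>lborel)
    \<in> borel_measurable (lborel \<Otimes>\<^sub>M M)"
proof -
  have "(\<lambda>q. (snd q, snd (fst q))) \<in> (lborel \<Otimes>\<^sub>M M) \<Otimes>\<^sub>M lborel \<rightarrow>\<^sub>M lborel \<Otimes>\<^sub>M M"
    by measurable
  from measurable_comp[OF this measurable_H_cut]
  have 1: "(\<lambda>q. H (snd q) (snd (fst q)) * indicator {0..T} (snd q)) \<in> borel_measurable ((lborel \<Otimes>\<^sub>M M) \<Otimes>\<^sub>M lborel)"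
    by (simp add: comp_def)
  have 2: "(\<lambda>q. indicator {0..fst (fst q) :: real} (snd q) :: ennreal) \<in> borel_measurable ((lborel \<Otimes>\<^sub>M M) \<Otimes>\<^sub>M lborel)"
  proof (rule borel_measurable_indicator')
    show "{q \<in> space ((lborel \<Otimes>\<^sub>M M) \<Otimes>\<^sub>M lborel). snd q \<in> {0..fst (fst q) :: real}}
        \<in> sets ((lborel \<Otimes>\<^sub>M M) \<Otimes>\<^sub>M lborel)"
      unfolding atLeastAtMost_iff by measurable
  qed
  have "(\<lambda>q. ennreal ((H (snd q) (snd (fst q)) * indicator {0..T} (snd q))\<^sup>2) * indicator {0..fst (fst q)} (snd q))
      \<in> borel_measurable ((lborel \<Otimes>\<^sub>M M) \<Otimes>\<^sub>M lborel)"
    using 1 2 by measurable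
  then show ?thesis
    by (intro lborel.borel_measurable_nn_integral) (simp add: case_prod_unfold)
qed

lemma expected_energy:
  assumes "0 \<le> a" "b \<le> T"
  shows "(\<integral>\<^sup>+\<omega>. energy a b \<omega> \<partial>M) = (\<integral>\<^sup>+t\<in>{a..b}. (\<integral>\<^sup>+\<omega>. ennreal ((H t \<omega>)\<^sup>2) \<partial>M) \<partial>lborel)"
proof -
  interpret P: pair_sigma_finite lborel M by unfold_locales
  let ?f = "\<lambda>t \<omega>. ennreal ((H t \<omega> * indicator {0..T} t)\<^sup>2) * indicator {a..b} t"
  note [measurable] = measurable_H_cut
  have f: "case_prod ?f \<in> borel_measurable (lborel \<Otimes>\<^sub>M M)"
    unfolding case_prod_unfold by measurable
  have "(\<integral>\<^sup>+\<omega>. energy a b \<omega> \<partial>M) = (\<integral>\<^sup>+\<omega>. \<integral>\<^sup>+t. ?f t \<omega> \<partial>lborel \<partial>M)"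
    unfolding energy_def using assms by (intro nn_integral_cong) (auto simp: indicator_def)
  also have "\<dots> = (\<integral>\<^sup>+t. \<integral>\<^sup>+\<omega>. ?f t \<omega> \<partial>M \<partial>lborel)" by (rule P.Fubini'[OF f])
  also have "\<dots> = (\<integral>\<^sup>+t\<in>{a..b}. (\<integral>\<^sup>+\<omega>. ennreal ((H t \<omega>)\<^sup>2) \<partial>M) \<partial>lborel)"
    using assms by (intro nn_integral_cong) (auto simp: indicator_def)
  finally show ?thesis .
qed

text \<open>One half of the Gronwall loop: the truncated energy is controlled by second moments
  restricted to the events of small energy. The other half is
  \<open>stopped_moment_le\<close>.\<close>

lemma expected_min_energy_le:
  assumes cont: "AE \<omega> in M. continuous_on {0..T} (\<lambda>t. H t \<omega>)" and t: "t \<in> {0..T}" and c: "0 < c"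
  shows "(\<integral>\<^sup>+\<omega>. min (ennreal c) (energy 0 t \<omega>) \<partial>M)
    \<le> (\<integral>\<^sup>+s\<in>{0..t}. (\<integral>\<^sup>+\<omega>. ennreal ((H s \<omega>)\<^sup>2) * indicator {\<omega>. energy 0 s \<omega> < ennreal c} \<omega> \<partial>M) \<partial>lborel)"
proof -
  interpret P: pair_sigma_finite lborel M by unfold_locales
  let ?E = "\<lambda>p. \<integral>\<^sup>+u\<in>{0..fst p}. ennreal ((H u (snd p) * indicator {0..T} u)\<^sup>2) \<partial>lborel"
  let ?f = "\<lambda>s \<omega>. ennreal ((H s \<omega> * indicator {0..T} s)\<^sup>2) * indicator {p. ?E p < ennreal c} (s, \<omega>) * indicator {0..t} s"
  have E: "?E (s, \<omega>) = energy 0 s \<omega>" if "s \<le> T" for s \<omega>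
    unfolding energy_def using that by (intro nn_integral_cong) (auto simp: indicator_def)
  have ind: "indicator {p. ?E p < ennreal c} (s, \<omega>) = (indicator {\<omega>. energy 0 s \<omega> < ennreal c} \<omega> :: ennreal)"
    if "s \<le> T" for s \<omega>
    using E[OF that, of \<omega>] by (simp only: indicator_def mem_Collect_eq)
  have f: "case_prod ?f \<in> borel_measurable (lborel \<Otimes>\<^sub>M M)"
  proof -
    note [measurable] = measurable_H_cut measurable_energy_joint
    have "(\<lambda>p. indicator {p. ?E p < ennreal c} p :: ennreal) \<in> borel_measurable (lborel \<Otimes>\<^sub>M M)"
      by (rule borel_measurable_indicator') measurable
    then show ?thesis unfolding case_prod_unfold prod.collapse by measurable
  qed
  have "(\<integral>\<^sup>+\<omega>. min (ennreal c) (energy 0 t \<omega>) \<partial>M) \<le> (\<integral>\<^sup>+\<omega>. \<integral>\<^sup>+s. ?f s \<omega> \<partial>lborel \<partial>M)"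
  proof (rule nn_integral_mono_AE, use cont in eventually_elim)
    case (elim \<omega>)
    have "min (ennreal c) (energy 0 t \<omega>)
       \<le> (\<integral>\<^sup>+s\<in>{0..t}. (ennreal ((H s \<omega>)\<^sup>2) * indicator {s. energy 0 s \<omega> < ennreal c} s) \<partial>lborel)"
      using min_energy_le_stopped_energy[OF elim, of t c] t c unfolding energy_def by simp
    also have "\<dots> = (\<integral>\<^sup>+s. ?f s \<omega> \<partial>lborel)"
    proof (intro nn_integral_cong)
      fix s
      show "ennreal ((H s \<omega>)\<^sup>2) * indicator {s. energy 0 s \<omega> < ennreal c} s * indicator {0..t} s = ?f s \<omega>"
        using t ind[of s \<omega>] by (cases "s \<in> {0..t}") (simp_all add: indicator_def)
    qed
    finally show ?case .
  qed
  also have "\<dots> = (\<integral>\<^sup>+s. \<integral>\<^sup>+\<omega>. ?f s \<omega> \<partial>M \<partial>lborel)" by (rule P.Fubini'[OF f])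
  also have "\<dots> = (\<integral>\<^sup>+s\<in>{0..t}. (\<integral>\<^sup>+\<omega>. ennreal ((H s \<omega>)\<^sup>2) * indicator {\<omega>. energy 0 s \<omega> < ennreal c} \<omega> \<partial>M) \<partial>lborel)"
  proof (intro nn_integral_cong)
    fix s
    show "(\<integral>\<^sup>+\<omega>. ?f s \<omega> \<partial>M) = (\<integral>\<^sup>+\<omega>. ennreal ((H s \<omega>)\<^sup>2) * indicator {\<omega>. energy 0 s \<omega> < ennreal c} \<omega> \<partial>M) * indicator {0..t} s"
    proof (cases "s \<in> {0..t}")
      case True
      then have "s \<le> T" using t by auto
      have "?f s \<omega> = ennreal ((H s \<omega>)\<^sup>2) * indicator {\<omega>. energy 0 s \<omega> < ennreal c} \<omega>" for \<omega>
        using True t unfolding ind[OF \<open>s \<le> T\<close>] by simp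
      then show ?thesis using True by simp
    qed simp
  qed
  finally show ?thesis .
qed

end

section \<open>Second moments from the integral equation\<close>

locale linear_ito_equation = ito_integral M F W T X I
  for M :: "'a measure" and F W T X I +
  fixes \<mu> \<sigma> :: real and X0 :: "'a \<Rightarrow> real"
  assumes T_pos: "0 < T"
    and X0_measurable: "X0 \<in> borel_measurable M"
    and X0_square: "integrable M (\<lambda>\<omega>. (X0 \<omega>)\<^sup>2)"
    and X_adapted: "adapted_on {0..T} F X"
    and X_continuous: "AE \<omega> in M. continuous_on {0..T} (\<lambda>t. X t \<omega>)"
    and X_initial: "AE \<omega> in M. X 0 \<omega> = X0 \<omega>"
    and X_eq: "\<And>t. t \<in> {0..T} \<Longrightarrow>
      AE \<omega> in M. X t \<omega> = X0 \<omega> + \<mu> * (LBINT s:{0..t}. X s \<omega>) + \<sigma> * I t \<omega>"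
begin

lemma measurable_X_F: "t \<in> {0..T} \<Longrightarrow> X t \<in> borel_measurable (F t)"
  using X_adapted unfolding adapted_on_def by auto

lemma measurable_X: "t \<in> {0..T} \<Longrightarrow> X t \<in> borel_measurable M"
  using measurable_F_M measurable_X_F by auto

text \<open>The equation is available almost surely at each fixed time. Subtracting it at two times
  removes \<open>X0\<close>, and Cauchy-Schwarz absorbs the drift into the energy.\<close>

lemma increment_power2_le:
  assumes ab: "0 \<le> a" "a \<le> b" "b \<le> T"
  shows "AE \<omega> in M. ennreal ((X b \<omega> - X a \<omega>)\<^sup>2)
    \<le> ennreal (2 * \<mu>\<^sup>2 * (b - a)) * energy a b \<omega> + ennreal (2 * \<sigma>\<^sup>2) * ennreal ((I b \<omega> - I a \<omega>)\<^sup>2)"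
proof -
  have "AE \<omega> in M. X a \<omega> = X0 \<omega> + \<mu> * (LBINT s:{0..a}. X s \<omega>) + \<sigma> * I a \<omega>"
    and "AE \<omega> in M. X b \<omega> = X0 \<omega> + \<mu> * (LBINT s:{0..b}. X s \<omega>) + \<sigma> * I b \<omega>"
    using X_eq ab by auto
  then show ?thesis
    using X_continuous
  proof eventually_elim
    case (elim \<omega>)
    let ?L = "(LBINT s:{0..b}. X s \<omega>) - (LBINT s:{0..a}. X s \<omega>)" and ?I = "I b \<omega> - I a \<omega>"
    have "X b \<omega> - X a \<omega> = \<mu> * ?L + \<sigma> * ?I" using elim(1,2) by (simp add: algebra_simps)
    then have "(X b \<omega> - X a \<omega>)\<^sup>2 \<le> 2 * (\<mu> * ?L)\<^sup>2 + 2 * (\<sigma> * ?I)\<^sup>2"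
      by (simp only: power2_add_le)
    also have "\<dots> = 2 * \<mu>\<^sup>2 * ?L\<^sup>2 + 2 * \<sigma>\<^sup>2 * ?I\<^sup>2" by (simp add: power_mult_distrib)
    finally have "ennreal ((X b \<omega> - X a \<omega>)\<^sup>2) \<le> ennreal (2 * \<mu>\<^sup>2) * ennreal (?L\<^sup>2) + ennreal (2 * \<sigma>\<^sup>2) * ennreal (?I\<^sup>2)"
      by (simp add: ennreal_mult[symmetric] ennreal_plus[symmetric] ennreal_leI del: ennreal_plus)
    also have "\<dots> \<le> ennreal (2 * \<mu>\<^sup>2) * (ennreal (b - a) * energy a b \<omega>) + ennreal (2 * \<sigma>\<^sup>2) * ennreal (?I\<^sup>2)"
      unfolding energy_def by (intro add_mono mult_mono set_integral_diff_power2_le[OF elim(3) ab]) auto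
    also have "ennreal (2 * \<mu>\<^sup>2) * (ennreal (b - a) * energy a b \<omega>) = ennreal (2 * \<mu>\<^sup>2 * (b - a)) * energy a b \<omega>"
      by (simp add: ennreal_mult' mult.assoc)
    finally show ?case .
  qed
qed

text \<open>The factors 4 come from splitting a square twice, first at \<open>X0\<close> and then
  into drift and noise. The noise appears as the increment \<open>I t - I 0\<close>, the quantity
  controlled by the localized isometry.\<close>

lemma value_power2_le:
  assumes t: "t \<in> {0..T}"
  shows "AE \<omega> in M. ennreal ((X t \<omega>)\<^sup>2) \<le> ennreal (2 * (X0 \<omega>)\<^sup>2)
    + (ennreal (4 * \<mu>\<^sup>2 * T) * energy 0 t \<omega> + ennreal (4 * \<sigma>\<^sup>2) * ennreal ((I t \<omega> - I 0 \<omega>)\<^sup>2))"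
proof -
  have "0 \<le> t" "t \<le> T" using t by auto
  from increment_power2_le[OF order_refl this] X_initial show ?thesis
  proof eventually_elim
    case (elim \<omega>)
    have "(X t \<omega>)\<^sup>2 \<le> 2 * (X0 \<omega>)\<^sup>2 + 2 * (X t \<omega> - X0 \<omega>)\<^sup>2"
      using power2_add_le[of "X0 \<omega>" "X t \<omega> - X0 \<omega>"] by simp
    then have "ennreal ((X t \<omega>)\<^sup>2) \<le> ennreal (2 * (X0 \<omega>)\<^sup>2) + ennreal 2 * ennreal ((X t \<omega> - X 0 \<omega>)\<^sup>2)"
      unfolding elim(2) by (simp add: ennreal_mult[symmetric] ennreal_plus[symmetric] ennreal_leI del: ennreal_plus ennreal_numeral)
    also have "\<dots> \<le> ennreal (2 * (X0 \<omega>)\<^sup>2) + ennreal 2 * (ennreal (2 * \<mu>\<^sup>2 * T) * energy 0 t \<omega>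
        + ennreal (2 * \<sigma>\<^sup>2) * ennreal ((I t \<omega> - I 0 \<omega>)\<^sup>2))"
    proof (intro add_left_mono mult_left_mono order_trans[OF elim(1)] add_right_mono mult_right_mono ennreal_leI)
      show "t - 0 \<le> T" using t by simp
    qed auto
    also have "ennreal 2 * (ennreal (2 * \<mu>\<^sup>2 * T) * energy 0 t \<omega> + ennreal (2 * \<sigma>\<^sup>2) * ennreal ((I t \<omega> - I 0 \<omega>)\<^sup>2))
      = ennreal (4 * \<mu>\<^sup>2 * T) * energy 0 t \<omega> + ennreal (4 * \<sigma>\<^sup>2) * ennreal ((I t \<omega> - I 0 \<omega>)\<^sup>2)"
      using T_pos by (simp add: distrib_left mult.assoc[symmetric] ennreal_mult[symmetric] del: ennreal_numeral)
    finally show ?case .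
  qed
qed

text \<open>\<open>energy_rate\<close> adds the drift and noise factors of
  \<open>value_power2_le\<close>; \<open>energy_bound\<close> is what
  \<open>gronwall_nn_integral\<close> yields at \<open>t = T\<close> with
  \<open>a = initial_moment\<close> and \<open>B = energy_rate\<close>. No truncation level occurs
  in these constants.\<close>

definition energy_rate :: real where "energy_rate = 4 * \<mu>\<^sup>2 * T + 4 * \<sigma>\<^sup>2"
definition initial_moment :: real where "initial_moment = 2 * (\<integral>\<omega>. (X0 \<omega>)\<^sup>2 \<partial>M)"
definition energy_bound :: real where
  "energy_bound = 2 * initial_moment * T * exp ((2 * energy_rate + 1) * T)"
definition moment_bound :: real where
  "moment_bound = initial_moment + energy_rate * energy_bound"

lemma bounds_nonneg: "0 \<le> energy_rate" "0 \<le> initial_moment" "0 \<le> energy_bound" "0 \<le> moment_bound"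
  using T_pos by (auto simp: energy_rate_def initial_moment_def energy_bound_def moment_bound_def)

lemma nn_integral_X0: "(\<integral>\<^sup>+\<omega>. ennreal (2 * (X0 \<omega>)\<^sup>2) \<partial>M) = ennreal initial_moment"
  unfolding initial_moment_def using X0_square by (subst nn_integral_eq_integral) auto

text \<open>On the event, the energy equals its truncation, which bounds the drift term; the
  localized isometry bounds the noise by the same quantity.\<close>

lemma stopped_moment_le:
  assumes t: "t \<in> {0..T}" and c: "0 < c"
  shows "(\<integral>\<^sup>+\<omega>. ennreal ((X t \<omega>)\<^sup>2) * indicator {\<omega>. energy 0 t \<omega> < ennreal c} \<omega> \<partial>M)
    \<le> ennreal initial_moment + ennreal energy_rate * (\<integral>\<^sup>+\<omega>. min (ennreal c) (energy 0 t \<omega>) \<partial>M)"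
proof -
  note [measurable] = X0_measurable
  have [measurable]: "energy 0 t \<in> borel_measurable M" "I 0 \<in> borel_measurable M" "I t \<in> borel_measurable M"
    using t measurable_I by auto
  let ?m = "\<lambda>\<omega>. min (ennreal c) (energy 0 t \<omega>)" and ?ind = "indicator {\<omega>. energy 0 t \<omega> < ennreal c} :: 'a \<Rightarrow> ennreal"
  have "(\<integral>\<^sup>+\<omega>. ennreal ((X t \<omega>)\<^sup>2) * ?ind \<omega> \<partial>M)
    \<le> (\<integral>\<^sup>+\<omega>. ennreal (2 * (X0 \<omega>)\<^sup>2) + (ennreal (4 * \<mu>\<^sup>2 * T) * ?m \<omega>
          + ennreal (4 * \<sigma>\<^sup>2) * (ennreal ((I t \<omega> - I 0 \<omega>)\<^sup>2) * ?ind \<omega>)) \<partial>M)"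
    by (intro nn_integral_mono_AE, use value_power2_le[OF t] in eventually_elim)
      (auto simp: indicator_def min_def)
  also have "\<dots> = ennreal initial_moment + (ennreal (4 * \<mu>\<^sup>2 * T) * (\<integral>\<^sup>+\<omega>. ?m \<omega> \<partial>M)
      + ennreal (4 * \<sigma>\<^sup>2) * (\<integral>\<^sup>+\<omega>. ennreal ((I t \<omega> - I 0 \<omega>)\<^sup>2) * ?ind \<omega> \<partial>M))"
    by (simp add: nn_integral_add nn_integral_cmult nn_integral_X0)
  also have "\<dots> \<le> ennreal initial_moment + (ennreal (4 * \<mu>\<^sup>2 * T) * (\<integral>\<^sup>+\<omega>. ?m \<omega> \<partial>M)
      + ennreal (4 * \<sigma>\<^sup>2) * (\<integral>\<^sup>+\<omega>. ?m \<omega> \<partial>M))"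
    using t c by (intro add_left_mono mult_left_mono ito_localized_isometry) auto
  also have "\<dots> = ennreal initial_moment + ennreal energy_rate * (\<integral>\<^sup>+\<omega>. ?m \<omega> \<partial>M)"
    unfolding energy_rate_def using T_pos by (simp add: distrib_right)
  finally show ?thesis .
qed

text \<open>Combining \<open>expected_min_energy_le\<close> with \<open>stopped_moment_le\<close>
  closes the Gronwall loop at each level, uniformly in the level. Levels are \<open>Suc n\<close>
  because they must be positive.\<close>

lemma expected_energy_le: "(\<integral>\<^sup>+\<omega>. energy 0 T \<omega> \<partial>M) \<le> ennreal energy_bound"
proof (rule nn_integral_le_of_AE_tendsto[where f = "\<lambda>n \<omega>. min (ennreal (real (Suc n))) (energy 0 T \<omega>)"])
  show "(\<lambda>\<omega>. min (ennreal (real (Suc n))) (energy 0 T \<omega>)) \<in> borel_measurable M" for n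
    by (intro borel_measurable_min measurable_energy) auto
  show "AE \<omega> in M. (\<lambda>n. min (ennreal (real (Suc n))) (energy 0 T \<omega>)) \<longlonglongrightarrow> energy 0 T \<omega>"
    using energy_finite
  proof eventually_elim
    case (elim \<omega>)
    then obtain r where r: "energy 0 T \<omega> = ennreal r" "0 \<le> r" by (cases "energy 0 T \<omega>") auto
    obtain n0 where "r < real n0" using reals_Archimedean2 by blast
    then have "min (ennreal (real (Suc n))) (energy 0 T \<omega>) = energy 0 T \<omega>" if "n0 \<le> n" for n
      unfolding r using that by (intro min_absorb2 ennreal_leI) simp
    then show ?case by (intro tendsto_eventually) (auto simp: eventually_sequentially)
  qed
  show "(\<integral>\<^sup>+\<omega>. min (ennreal (real (Suc n))) (energy 0 T \<omega>) \<partial>M) \<le> ennreal energy_bound" for n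
    unfolding energy_bound_def
  proof (rule gronwall_nn_integral[where c = "real (Suc n)"])
    let ?h = "\<lambda>t. \<integral>\<^sup>+\<omega>. min (ennreal (real (Suc n))) (energy 0 t \<omega>) \<partial>M"
    fix t assume t: "t \<in> {0..T}"
    have "?h t \<le> (\<integral>\<^sup>+\<omega>. ennreal (real (Suc n)) \<partial>M)" by (intro nn_integral_mono) simp
    then show "?h t \<le> ennreal (real (Suc n))" by (simp add: emeasure_space_1)
    have "?h t \<le> (\<integral>\<^sup>+s\<in>{0..t}. (\<integral>\<^sup>+\<omega>. ennreal ((X s \<omega>)\<^sup>2) * indicator {\<omega>. energy 0 s \<omega> < ennreal (real (Suc n))} \<omega> \<partial>M) \<partial>lborel)"
      by (rule expected_min_energy_le[OF X_continuous t]) simp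
    also have "\<dots> \<le> (\<integral>\<^sup>+s\<in>{0..t}. (ennreal initial_moment + ennreal energy_rate * ?h s) \<partial>lborel)"
    proof (intro nn_integral_mono)
      fix s
      show "(\<integral>\<^sup>+\<omega>. ennreal ((X s \<omega>)\<^sup>2) * indicator {\<omega>. energy 0 s \<omega> < ennreal (real (Suc n))} \<omega> \<partial>M) * indicator {0..t} s
        \<le> (ennreal initial_moment + ennreal energy_rate * ?h s) * indicator {0..t} s"
        using stopped_moment_le[of s "real (Suc n)"] t by (cases "s \<in> {0..t}") auto
    qed
    finally show "?h t \<le> (\<integral>\<^sup>+s\<in>{0..t}. (ennreal initial_moment + ennreal energy_rate * ?h s) \<partial>lborel)" .
  qed (use T_pos bounds_nonneg in auto)
qed

lemma second_moment_le:
  assumes t: "t \<in> {0..T}"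
  shows "(\<integral>\<^sup>+\<omega>. ennreal ((X t \<omega>)\<^sup>2) \<partial>M) \<le> ennreal moment_bound"
proof -
  note [measurable] = X0_measurable
  have [measurable]: "energy 0 t \<in> borel_measurable M" "I 0 \<in> borel_measurable M" "I t \<in> borel_measurable M"
    using t measurable_I by auto
  let ?E = "\<integral>\<^sup>+\<omega>. energy 0 t \<omega> \<partial>M"
  have "(\<integral>\<^sup>+\<omega>. ennreal ((X t \<omega>)\<^sup>2) \<partial>M) \<le> (\<integral>\<^sup>+\<omega>. ennreal (2 * (X0 \<omega>)\<^sup>2)
      + (ennreal (4 * \<mu>\<^sup>2 * T) * energy 0 t \<omega> + ennreal (4 * \<sigma>\<^sup>2) * ennreal ((I t \<omega> - I 0 \<omega>)\<^sup>2)) \<partial>M)"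
    by (rule nn_integral_mono_AE[OF value_power2_le[OF t]])
  also have "\<dots> = ennreal initial_moment + (ennreal (4 * \<mu>\<^sup>2 * T) * ?E
      + ennreal (4 * \<sigma>\<^sup>2) * (\<integral>\<^sup>+\<omega>. ennreal ((I t \<omega> - I 0 \<omega>)\<^sup>2) \<partial>M))"
    by (simp add: nn_integral_add nn_integral_cmult nn_integral_X0)
  also have "\<dots> \<le> ennreal initial_moment + (ennreal (4 * \<mu>\<^sup>2 * T) * ?E + ennreal (4 * \<sigma>\<^sup>2) * ?E)"
    using t by (intro add_left_mono mult_left_mono ito_isometry_le) auto
  also have "\<dots> = ennreal initial_moment + ennreal energy_rate * ?E"
    unfolding energy_rate_def using T_pos by (simp add: distrib_right)
  also have "?E \<le> (\<integral>\<^sup>+\<omega>. energy 0 T \<omega> \<partial>M)" using t by (intro nn_integral_mono energy_mono) auto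
  also have "\<dots> \<le> ennreal energy_bound" by (rule expected_energy_le)
  also have "ennreal initial_moment + ennreal energy_rate * ennreal energy_bound = ennreal moment_bound"
    unfolding moment_bound_def using bounds_nonneg by (simp add: ennreal_mult ennreal_plus)
  finally show ?thesis by (simp add: add_left_mono mult_left_mono)
qed

definition increment_bound :: real where
  "increment_bound = (2 * \<mu>\<^sup>2 * T + 2 * \<sigma>\<^sup>2) * moment_bound"

text \<open>By Fubini the expected energy over \<open>[a, b]\<close> is linear in
  \<open>b - a\<close>. The additional factor \<open>b - a\<close> of the drift is coarsened to
  \<open>T\<close>, as the noise is linear in \<open>b - a\<close> anyway.\<close>

lemma increment_moment_le:
  assumes ab: "0 \<le> a" "a \<le> b" "b \<le> T"
  shows "(\<integral>\<^sup>+\<omega>. ennreal ((X b \<omega> - X a \<omega>)\<^sup>2) \<partial>M) \<le> ennreal (increment_bound * (b - a))"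
proof -
  have [measurable]: "energy a b \<in> borel_measurable M" "I a \<in> borel_measurable M" "I b \<in> borel_measurable M"
    using ab measurable_I by auto
  let ?E = "\<integral>\<^sup>+\<omega>. energy a b \<omega> \<partial>M"
  have "?E \<le> (\<integral>\<^sup>+t. ennreal moment_bound * indicator {a..b} t \<partial>lborel)"
    unfolding expected_energy[OF ab(1,3)] using second_moment_le ab
    by (intro nn_integral_mono) (auto simp: indicator_def)
  also have "\<dots> = ennreal (moment_bound * (b - a))"
    using ab bounds_nonneg by (simp add: nn_integral_cmult_indicator ennreal_mult')
  finally have E: "?E \<le> ennreal (moment_bound * (b - a))" .
  have "(\<integral>\<^sup>+\<omega>. ennreal ((X b \<omega> - X a \<omega>)\<^sup>2) \<partial>M)
    \<le> (\<integral>\<^sup>+\<omega>. ennreal (2 * \<mu>\<^sup>2 * (b - a)) * energy a b \<omega> + ennreal (2 * \<sigma>\<^sup>2) * ennreal ((I b \<omega> - I a \<omega>)\<^sup>2) \<partial>M)"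
    by (rule nn_integral_mono_AE[OF increment_power2_le[OF ab]])
  also have "\<dots> = ennreal (2 * \<mu>\<^sup>2 * (b - a)) * ?E + ennreal (2 * \<sigma>\<^sup>2) * (\<integral>\<^sup>+\<omega>. ennreal ((I b \<omega> - I a \<omega>)\<^sup>2) \<partial>M)"
    by (simp add: nn_integral_add nn_integral_cmult)
  also have "\<dots> \<le> ennreal (2 * \<mu>\<^sup>2 * T) * ?E + ennreal (2 * \<sigma>\<^sup>2) * ?E"
    using ab by (intro add_mono mult_mono ito_isometry_le ennreal_leI) auto
  also have "\<dots> = ennreal (2 * \<mu>\<^sup>2 * T + 2 * \<sigma>\<^sup>2) * ?E"
    using T_pos by (simp add: distrib_right)
  also have "\<dots> \<le> ennreal (2 * \<mu>\<^sup>2 * T + 2 * \<sigma>\<^sup>2) * ennreal (moment_bound * (b - a))"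
    by (intro mult_left_mono E) simp
  also have "\<dots> = ennreal (increment_bound * (b - a))"
    unfolding increment_bound_def using T_pos ab bounds_nonneg
    by (simp add: ennreal_mult[symmetric] mult.assoc del: ennreal_plus)
  finally show ?thesis .
qed

end

section \<open>Explicit and implicit form of the scheme\<close>

text \<open>The denominator of \<open>alpha\<close> at \<open>z = \<mu> h / 12\<close> has negative
  discriminant, so only the denominator of \<open>beta\<close> restricts the step size.\<close>

lemma denominator_nonzero: "1 - 12 * z + 48 * z\<^sup>2 \<noteq> 0" for z :: real
proof -
  have "1 - 12 * z + 48 * z\<^sup>2 = 12 * (2 * z - 1/4)\<^sup>2 + 1/4"
    by (simp add: power2_eq_square algebra_simps)
  then show ?thesis using zero_le_power2[of "2 * z - 1/4"] by linarith
qed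

text \<open>With \<open>z = \<mu> h / 12\<close> all coefficients of the block become integers.\<close>

lemma block_system_iff:
  fixes z c d y0 y1 y2 :: real
  assumes z: "4 * z \<noteq> 1"
    and A: "(1 - 12 * z + 48 * z\<^sup>2) * A = 1 - 24 * z\<^sup>2 - z * d + (1 - 4 * z) * c"
  shows "(y1 = A * y0 \<and> (1 - 4 * z) * y2 = (1 + 4 * z + 16 * z * A + d) * y0)
   \<longleftrightarrow> (y1 = y0 + (5 * z * y0 + 8 * z * y1 - z * y2) + y0 * c
        \<and> y2 = y0 + (4 * z * y0 + 16 * z * y1 + 4 * z * y2) + y0 * d)"
proof safe
  assume y2: "(1 - 4 * z) * y2 = (1 + 4 * z + 16 * z * A + d) * y0"
  show "y2 = y0 + (4 * z * y0 + 16 * z * (A * y0) + 4 * z * y2) + y0 * d"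
    using y2 by (simp add: algebra_simps)
  \<comment> \<open>Multiplying the residual by \<open>1 - 4 * z\<close> lets \<open>y2\<close> be
    eliminated through its formula.\<close>
  have "(1 - 4 * z) * (A * y0 - (y0 + (5 * z * y0 + 8 * z * (A * y0) - z * y2) + y0 * c)) = 0"
    using y2 A by algebra
  then show "A * y0 = y0 + (5 * z * y0 + 8 * z * (A * y0) - z * y2) + y0 * c"
    using z by simp
next
  assume y1: "y1 = y0 + (5 * z * y0 + 8 * z * y1 - z * y2) + y0 * c"
    and y2: "y2 = y0 + (4 * z * y0 + 16 * z * y1 + 4 * z * y2) + y0 * d"
  note denominator_nonzero[of z]
  \<comment> \<open>Cramer's rule for \<open>y1\<close>: the factor is the determinant of the linear
    system in \<open>y1\<close> and \<open>y2\<close>.\<close>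
  moreover have "(1 - 12 * z + 48 * z\<^sup>2) * (y1 - A * y0) = 0"
    using y1 y2 A by algebra
  ultimately show y1: "y1 = A * y0" by simp
  show "(1 - 4 * z) * y2 = (1 + 4 * z + 16 * z * A + d) * y0"
    using y2 unfolding y1 by (simp add: algebra_simps)
qed

lemma scheme_iff_implicit_scheme:
  assumes "\<mu> * h \<noteq> 3"
  shows "scheme \<mu> \<sigma> h w N y \<longleftrightarrow> implicit_scheme \<mu> \<sigma> h w N y"
proof -
  define z where "z = \<mu> * h / 12"
  have \<mu>h: "\<mu> * h = 12 * z" and z: "1 - 4 * z \<noteq> 0" using assms by (auto simp: z_def)
  have "(y (2*n + 1) = alpha \<mu> \<sigma> h w n * y (2*n) \<and> y (2*n + 2) = beta \<mu> \<sigma> h w n * y (2*n)) \<longleftrightarrow>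
     (y (2*n + 1) = rhs1 \<mu> \<sigma> h w n (y (2*n)) (y (2*n + 1)) (y (2*n + 2)) \<and>
      y (2*n + 2) = rhs2 \<mu> \<sigma> h w n (y (2*n)) (y (2*n + 1)) (y (2*n + 2)))" for n
  proof -
    define A c d where "A = alpha \<mu> \<sigma> h w n" and "c = \<sigma> * dW1 h w n" and "d = \<sigma> * dW2 h w n"
    have "A = (1 - 24 * z\<^sup>2 - z * d + (1 - 4 * z) * c) / (1 - 12 * z + 48 * z\<^sup>2)"
      unfolding A_def c_def d_def alpha_def \<mu>h by (simp add: power2_eq_square mult_ac)
    then have A: "(1 - 12 * z + 48 * z\<^sup>2) * A = 1 - 24 * z\<^sup>2 - z * d + (1 - 4 * z) * c"
      using denominator_nonzero[of z] by simp
    have beta: "beta \<mu> \<sigma> h w n = (1 + 4 * z + 16 * z * A + d) / (1 - 4 * z)"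
      unfolding beta_def A_def[symmetric] d_def using \<mu>h by simp
    have b: "y (2*n + 2) = beta \<mu> \<sigma> h w n * y (2*n) \<longleftrightarrow>
        (1 - 4 * z) * y (2*n + 2) = (1 + 4 * z + 16 * z * A + d) * y (2*n)"
      unfolding beta by (simp only: times_divide_eq_left nonzero_eq_divide_eq[OF z] mult.commute[of "1 - 4 * z"])
    have r1: "rhs1 \<mu> \<sigma> h w n x0 x1 x2 = x0 + (5 * z * x0 + 8 * z * x1 - z * x2) + x0 * c" for x0 x1 x2
      unfolding rhs1_def c_def z_def by (simp add: field_simps)
    have r2: "rhs2 \<mu> \<sigma> h w n x0 x1 x2 = x0 + (4 * z * x0 + 16 * z * x1 + 4 * z * x2) + x0 * d" for x0 x1 x2
      unfolding rhs2_def d_def z_def by (simp add: field_simps)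
    show ?thesis
      unfolding b r1 r2 A_def[symmetric] by (rule block_system_iff[OF _ A]) (use z in simp)
  qed
  then show ?thesis unfolding scheme_def implicit_scheme_def by blast
qed

section \<open>Mean-square size of the local error\<close>

context linear_ito_equation
begin

text \<open>The numbers are 2 times 2, 24 times 3 and 4 times 2: the factors of the pointwise
  estimate in \<open>defect_moment_le\<close> times, respectively, \<open>t - s \<le> 2 * h\<close>,
  three moments, and again \<open>t - s \<le> 2 * h\<close>.\<close>

definition defect_bound :: real where
  "defect_bound = 4 * increment_bound + 72 * \<mu>\<^sup>2 * T * moment_bound + 8 * \<sigma>\<^sup>2 * moment_bound"

lemma defect_bound_nonneg: "0 \<le> defect_bound"
  unfolding defect_bound_def increment_bound_def using T_pos bounds_nonneg by simp

text \<open>Free coefficients let one estimate cover odd and even grid points. The noise term keeps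
  order \<open>h\<close> because \<open>X s\<close> is known at time \<open>s\<close>, so its square
  factors out of the squared increment.\<close>

lemma defect_moment_le:
  fixes c0 c1 c2 h s t s1 s2 :: real
  assumes st: "0 \<le> s" "s \<le> t" "t \<le> T" and h: "t - s \<le> 2 * h" "0 \<le> h" "h \<le> T"
    and s12: "s1 \<in> {0..T}" "s2 \<in> {0..T}" and coeffs: "\<bar>c0\<bar> \<le> 4/3" "\<bar>c1\<bar> \<le> 4/3" "\<bar>c2\<bar> \<le> 4/3"
  shows "(\<integral>\<^sup>+\<omega>. ennreal ((X t \<omega> - (X s \<omega> + \<mu> * (c0 * h * X s \<omega> + c1 * h * X s1 \<omega> + c2 * h * X s2 \<omega>)
      + \<sigma> * X s \<omega> * (W t \<omega> - W s \<omega>)))\<^sup>2) \<partial>M) \<le> ennreal (defect_bound * h)"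
proof -
  have sT: "s \<in> {0..T}" using st by auto
  have [measurable]: "X s \<in> borel_measurable M" "X t \<in> borel_measurable M" "X s1 \<in> borel_measurable M"
    "X s2 \<in> borel_measurable M" "W s \<in> borel_measurable M" "W t \<in> borel_measurable M"
    using measurable_X measurable_W st s12 by auto
  have three: "(a + b + c)\<^sup>2 \<le> 3 * (a\<^sup>2 + b\<^sup>2 + c\<^sup>2)" for a b c :: real
    using zero_le_power2[of "a - b"] zero_le_power2[of "b - c"] zero_le_power2[of "a - c"]
    by (simp add: power2_eq_square algebra_simps)
  have scale: "(c * x)\<^sup>2 \<le> 2 * x\<^sup>2" if "\<bar>c\<bar> \<le> 4/3" for c x :: real
  proof -
    have "c\<^sup>2 \<le> (4/3)\<^sup>2" using that by (intro abs_le_square_iff[THEN iffD1]) simp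
    then have "c\<^sup>2 \<le> 2" by (simp add: power2_eq_square)
    then show ?thesis by (simp add: power_mult_distrib mult_right_mono)
  qed
  let ?Y = "\<lambda>u \<omega>. ennreal ((X u \<omega>)\<^sup>2)"
  have "(X t \<omega> - (X s \<omega> + \<mu> * (c0 * h * X s \<omega> + c1 * h * X s1 \<omega> + c2 * h * X s2 \<omega>)
      + \<sigma> * X s \<omega> * (W t \<omega> - W s \<omega>)))\<^sup>2
    \<le> 2 * (X t \<omega> - X s \<omega>)\<^sup>2 + 24 * \<mu>\<^sup>2 * T * h * ((X s \<omega>)\<^sup>2 + (X s1 \<omega>)\<^sup>2 + (X s2 \<omega>)\<^sup>2)
      + 4 * \<sigma>\<^sup>2 * ((X s \<omega>)\<^sup>2 * (W t \<omega> - W s \<omega>)\<^sup>2)" for \<omega>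
  proof -
    define D where "D = c0 * X s \<omega> + c1 * X s1 \<omega> + c2 * X s2 \<omega>"
    define S where "S = (X s \<omega>)\<^sup>2 + (X s1 \<omega>)\<^sup>2 + (X s2 \<omega>)\<^sup>2"
    define G where "G = \<sigma> * X s \<omega> * (W t \<omega> - W s \<omega>)"
    have "D\<^sup>2 \<le> 3 * ((c0 * X s \<omega>)\<^sup>2 + (c1 * X s1 \<omega>)\<^sup>2 + (c2 * X s2 \<omega>)\<^sup>2)" unfolding D_def by (rule three)
    also have "\<dots> \<le> 3 * (2 * (X s \<omega>)\<^sup>2 + 2 * (X s1 \<omega>)\<^sup>2 + 2 * (X s2 \<omega>)\<^sup>2)"
      by (intro mult_left_mono add_mono scale coeffs) simp
    finally have D: "D\<^sup>2 \<le> 6 * S" unfolding S_def by simp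
    \<comment> \<open>The quadrature part is of order \<open>h\<close> squared; one factor
      \<open>h\<close> is replaced by \<open>T\<close> to match the other terms.\<close>
    have "(\<mu> * h * D)\<^sup>2 = \<mu>\<^sup>2 * (h * h) * D\<^sup>2" by (simp add: power2_eq_square mult_ac)
    also have "\<dots> \<le> \<mu>\<^sup>2 * (T * h) * (6 * S)"
      using h T_pos D by (intro mult_mono) auto
    finally have E: "(\<mu> * h * D)\<^sup>2 \<le> 6 * \<mu>\<^sup>2 * T * h * S" by (simp add: mult_ac)
    have "X t \<omega> - (X s \<omega> + \<mu> * (c0 * h * X s \<omega> + c1 * h * X s1 \<omega> + c2 * h * X s2 \<omega>) + G)
      = (X t \<omega> - X s \<omega>) + - (\<mu> * h * D + G)"
      unfolding D_def by (simp add: algebra_simps)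
    also have "\<dots>\<^sup>2 \<le> 2 * (X t \<omega> - X s \<omega>)\<^sup>2 + 2 * (\<mu> * h * D + G)\<^sup>2"
      using power2_add_le[of "X t \<omega> - X s \<omega>" "- (\<mu> * h * D + G)"] by (simp only: power2_minus)
    also have "\<dots> \<le> 2 * (X t \<omega> - X s \<omega>)\<^sup>2 + (24 * \<mu>\<^sup>2 * T * h * S + 4 * G\<^sup>2)"
      using power2_add_le[of "\<mu> * h * D" G] E by simp
    also have "G\<^sup>2 = \<sigma>\<^sup>2 * ((X s \<omega>)\<^sup>2 * (W t \<omega> - W s \<omega>)\<^sup>2)" unfolding G_def by (simp add: power_mult_distrib)
    finally show ?thesis unfolding G_def S_def by simp
  qed
  then have "ennreal ((X t \<omega> - (X s \<omega> + \<mu> * (c0 * h * X s \<omega> + c1 * h * X s1 \<omega> + c2 * h * X s2 \<omega>)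
      + \<sigma> * X s \<omega> * (W t \<omega> - W s \<omega>)))\<^sup>2)
    \<le> ennreal 2 * ennreal ((X t \<omega> - X s \<omega>)\<^sup>2) + ennreal (24 * \<mu>\<^sup>2 * T * h) * (?Y s \<omega> + ?Y s1 \<omega> + ?Y s2 \<omega>)
      + ennreal (4 * \<sigma>\<^sup>2) * (?Y s \<omega> * ennreal ((W t \<omega> - W s \<omega>)\<^sup>2))" for \<omega>
    using h T_pos
    by (simp add: ennreal_mult[symmetric] ennreal_plus[symmetric] ennreal_leI del: ennreal_plus ennreal_numeral)
  then have "(\<integral>\<^sup>+\<omega>. ennreal ((X t \<omega> - (X s \<omega> + \<mu> * (c0 * h * X s \<omega> + c1 * h * X s1 \<omega> + c2 * h * X s2 \<omega>)
      + \<sigma> * X s \<omega> * (W t \<omega> - W s \<omega>)))\<^sup>2) \<partial>M)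
    \<le> (\<integral>\<^sup>+\<omega>. ennreal 2 * ennreal ((X t \<omega> - X s \<omega>)\<^sup>2) + ennreal (24 * \<mu>\<^sup>2 * T * h) * (?Y s \<omega> + ?Y s1 \<omega> + ?Y s2 \<omega>)
      + ennreal (4 * \<sigma>\<^sup>2) * (?Y s \<omega> * ennreal ((W t \<omega> - W s \<omega>)\<^sup>2)) \<partial>M)"
    by (intro nn_integral_mono)
  also have "\<dots> = ennreal 2 * (\<integral>\<^sup>+\<omega>. ennreal ((X t \<omega> - X s \<omega>)\<^sup>2) \<partial>M)
      + ennreal (24 * \<mu>\<^sup>2 * T * h) * ((\<integral>\<^sup>+\<omega>. ?Y s \<omega> \<partial>M) + (\<integral>\<^sup>+\<omega>. ?Y s1 \<omega> \<partial>M) + (\<integral>\<^sup>+\<omega>. ?Y s2 \<omega> \<partial>M))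
      + ennreal (4 * \<sigma>\<^sup>2) * (\<integral>\<^sup>+\<omega>. ?Y s \<omega> * ennreal ((W t \<omega> - W s \<omega>)\<^sup>2) \<partial>M)"
    by (simp add: nn_integral_add nn_integral_cmult del: ennreal_numeral)
  also have "(\<integral>\<^sup>+\<omega>. ?Y s \<omega> * ennreal ((W t \<omega> - W s \<omega>)\<^sup>2) \<partial>M) = ennreal (t - s) * (\<integral>\<^sup>+\<omega>. ?Y s \<omega> \<partial>M)"
    using measurable_X_F[OF sT] st by (intro nn_integral_mult_increment_sq) auto
  also have "ennreal 2 * (\<integral>\<^sup>+\<omega>. ennreal ((X t \<omega> - X s \<omega>)\<^sup>2) \<partial>M)
      + ennreal (24 * \<mu>\<^sup>2 * T * h) * ((\<integral>\<^sup>+\<omega>. ?Y s \<omega> \<partial>M) + (\<integral>\<^sup>+\<omega>. ?Y s1 \<omega> \<partial>M) + (\<integral>\<^sup>+\<omega>. ?Y s2 \<omega> \<partial>M))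
      + ennreal (4 * \<sigma>\<^sup>2) * (ennreal (t - s) * (\<integral>\<^sup>+\<omega>. ?Y s \<omega> \<partial>M))
    \<le> ennreal 2 * ennreal (increment_bound * (t - s))
      + ennreal (24 * \<mu>\<^sup>2 * T * h) * (ennreal moment_bound + ennreal moment_bound + ennreal moment_bound)
      + ennreal (4 * \<sigma>\<^sup>2) * (ennreal (t - s) * ennreal moment_bound)"
    by (intro add_mono mult_left_mono second_moment_le increment_moment_le st s12 sT) auto
  also have "\<dots> = ennreal (2 * (increment_bound * (t - s)) + 24 * \<mu>\<^sup>2 * T * h * (moment_bound + moment_bound + moment_bound)
      + 4 * \<sigma>\<^sup>2 * ((t - s) * moment_bound))"
  proof -
    have "0 \<le> increment_bound" unfolding increment_bound_def using T_pos bounds_nonneg by simp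
    then show ?thesis using h T_pos bounds_nonneg st
      by (simp add: ennreal_mult[symmetric] ennreal_plus[symmetric] del: ennreal_plus ennreal_numeral)
  qed
  also have "\<dots> \<le> ennreal (defect_bound * h)"
  proof (rule ennreal_leI)
    have "0 \<le> increment_bound" unfolding increment_bound_def using T_pos bounds_nonneg by simp
    then have "increment_bound * (t - s) \<le> increment_bound * (2 * h)"
      "(\<sigma>\<^sup>2 * moment_bound) * (t - s) \<le> (\<sigma>\<^sup>2 * moment_bound) * (2 * h)"
      using h(1) bounds_nonneg by (intro mult_left_mono; simp)+
    then show "2 * (increment_bound * (t - s)) + 24 * \<mu>\<^sup>2 * T * h * (moment_bound + moment_bound + moment_bound)
      + 4 * \<sigma>\<^sup>2 * ((t - s) * moment_bound) \<le> defect_bound * h"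
      unfolding defect_bound_def by (simp add: algebra_simps)
  qed
  finally show ?thesis .
qed

lemma local_error_moment_le:
  fixes N k :: nat
  assumes N: "0 < N" "even N" and k: "k \<in> {1..N}"
  defines "h \<equiv> T / real N"
  shows "(\<lambda>\<omega>. local_error \<mu> \<sigma> h (\<lambda>t. W t \<omega>) (\<lambda>t. X t \<omega>) k) \<in> borel_measurable M"
    and "(\<integral>\<^sup>+\<omega>. ennreal ((local_error \<mu> \<sigma> h (\<lambda>t. W t \<omega>) (\<lambda>t. X t \<omega>) k)\<^sup>2) \<partial>M) \<le> ennreal (defect_bound * h)"
proof -
  define n where "n = (k - 1) div 2"
  have kn: "if odd k then k = 2 * n + 1 else k = 2 * n + 2"
    using k unfolding n_def by (auto elim!: oddE evenE)
  \<comment> \<open>For odd \<open>k\<close> the block reaches to \<open>k + 1\<close>, one point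
    beyond \<open>k\<close>; evenness of \<open>N\<close> keeps that point inside the grid.\<close>
  then have nN: "2 * n + 2 \<le> N" using k N(2) by (auto split: if_splits) presburger
  have h: "0 < h" using T_pos N by (simp add: h_def)
  have Nh: "real N * h = T" using N by (simp add: h_def)
  have grid: "real j * h \<in> {0..T}" if "j \<le> N" for j
    using that h mult_right_mono[of "real j" "real N" h] unfolding Nh by auto
  have hT: "h \<le> T" using grid[of 1] N by auto
  define s s1 s2 where "s = real (2 * n) * h" and "s1 = real (2 * n + 1) * h" and "s2 = real (2 * n + 2) * h"
  have mem: "s \<in> {0..T}" "s1 \<in> {0..T}" "s2 \<in> {0..T}"
    unfolding s_def s1_def s2_def by (rule grid, use nN in simp)+
  have diff: "s1 - s = h" "s2 - s = 2 * h" unfolding s_def s1_def s2_def by (simp_all add: algebra_simps)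
  obtain c0 c1 c2 t where t: "t = s1 \<or> t = s2" and c: "\<bar>c0\<bar> \<le> 4/3" "\<bar>c1\<bar> \<le> 4/3" "\<bar>c2\<bar> \<le> (4/3 :: real)"
    and err: "\<And>\<omega>. local_error \<mu> \<sigma> h (\<lambda>t. W t \<omega>) (\<lambda>t. X t \<omega>) k =
      X t \<omega> - (X s \<omega> + \<mu> * (c0 * h * X s \<omega> + c1 * h * X s1 \<omega> + c2 * h * X s2 \<omega>) + \<sigma> * X s \<omega> * (W t \<omega> - W s \<omega>))"
  proof (cases "odd k")
    case True
    then have "real k * h = s1" using kn unfolding s1_def by simp
    then have "local_error \<mu> \<sigma> h (\<lambda>t. W t \<omega>) (\<lambda>t. X t \<omega>) k = X s1 \<omega> -
        (X s \<omega> + \<mu> * (5*h / 12 * X s \<omega> + 2*h / 3 * X s1 \<omega> - h / 12 * X s2 \<omega>) + \<sigma> * X s \<omega> * (W s1 \<omega> - W s \<omega>))" for \<omega>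
      using True by (simp only: local_error_def local_value_def Let_def n_def[symmetric] s_def[symmetric]
          s1_def[symmetric] s2_def[symmetric] rhs1_def dW1_def not_False_eq_True if_True)
    then show ?thesis
      by (intro that[of s1 "5/12" "2/3" "-1/12"]) (simp_all add: algebra_simps)
  next
    case False
    then have "real k * h = s2" using kn unfolding s2_def by simp
    then have "local_error \<mu> \<sigma> h (\<lambda>t. W t \<omega>) (\<lambda>t. X t \<omega>) k = X s2 \<omega> -
        (X s \<omega> + \<mu> * (h / 3 * X s \<omega> + 4*h / 3 * X s1 \<omega> + h / 3 * X s2 \<omega>) + \<sigma> * X s \<omega> * (W s2 \<omega> - W s \<omega>))" for \<omega>
      using False by (simp only: local_error_def local_value_def Let_def n_def[symmetric] s_def[symmetric]
          s1_def[symmetric] s2_def[symmetric] rhs2_def dW2_def if_False)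
    then show ?thesis
      by (intro that[of s2 "1/3" "4/3" "1/3"]) (simp_all add: algebra_simps)
  qed
  have tT: "0 \<le> s" "s \<le> t" "t \<le> T" "t - s \<le> 2 * h" using t mem diff h by auto
  have [measurable]: "X s \<in> borel_measurable M" "X t \<in> borel_measurable M" "X s1 \<in> borel_measurable M"
    "X s2 \<in> borel_measurable M" "W s \<in> borel_measurable M" "W t \<in> borel_measurable M"
    using measurable_X measurable_W tT mem by auto
  show "(\<lambda>\<omega>. local_error \<mu> \<sigma> h (\<lambda>t. W t \<omega>) (\<lambda>t. X t \<omega>) k) \<in> borel_measurable M"
    unfolding err by measurable
  show "(\<integral>\<^sup>+\<omega>. ennreal ((local_error \<mu> \<sigma> h (\<lambda>t. W t \<omega>) (\<lambda>t. X t \<omega>) k)\<^sup>2) \<partial>M) \<le> ennreal (defect_bound * h)"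
    unfolding err using h by (intro defect_moment_le tT mem c hT) auto
qed

lemma local_error_mean_square_le:
  fixes N k :: nat
  assumes "0 < N" "even N" "k \<in> {1..N}"
  shows "integrable M (\<lambda>\<omega>. \<bar>local_error \<mu> \<sigma> (T / real N) (\<lambda>t. W t \<omega>) (\<lambda>t. X t \<omega>) k\<bar>\<^sup>2)"
    and "(\<integral>\<omega>. \<bar>local_error \<mu> \<sigma> (T / real N) (\<lambda>t. W t \<omega>) (\<lambda>t. X t \<omega>) k\<bar>\<^sup>2 \<partial>M) \<le> defect_bound * (T / real N)"
proof -
  let ?e = "\<lambda>\<omega>. local_error \<mu> \<sigma> (T / real N) (\<lambda>t. W t \<omega>) (\<lambda>t. X t \<omega>) k"
  note le = local_error_moment_le[OF assms]
  have "integrable M (\<lambda>\<omega>. (?e \<omega>)\<^sup>2)"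
    using le by (intro square_integrableI) (auto intro: order_le_less_trans)
  then show int: "integrable M (\<lambda>\<omega>. \<bar>?e \<omega>\<bar>\<^sup>2)" by simp
  have "ennreal (\<integral>\<omega>. \<bar>?e \<omega>\<bar>\<^sup>2 \<partial>M) = (\<integral>\<^sup>+\<omega>. ennreal (\<bar>?e \<omega>\<bar>\<^sup>2) \<partial>M)"
    by (intro nn_integral_eq_integral[symmetric] int) simp
  also have "\<dots> \<le> ennreal (defect_bound * (T / real N))" using le(2) by simp
  finally show "(\<integral>\<omega>. \<bar>?e \<omega>\<bar>\<^sup>2 \<partial>M) \<le> defect_bound * (T / real N)"
    using T_pos defect_bound_nonneg by (subst (asm) ennreal_le_iff) auto
qed

end

theorem theorem2:
  fixes M :: "'a measure" and F :: "real \<Rightarrow> 'a measure"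
    and W X :: "real \<Rightarrow> 'a \<Rightarrow> real" and X0 :: "'a \<Rightarrow> real"
    and \<mu> \<sigma> T :: real
  assumes "filtered_prob_space M F"
    and "wiener_process M F W"
    and "T > 0"
    and "X0 \<in> borel_measurable (F 0)"
    and "integrable M (\<lambda>\<omega>. (X0 \<omega>)\<^sup>2)"
    and "ito_linear_solution M F W T \<mu> \<sigma> X0 X"
  shows "(\<forall>N>0. even N \<and> \<mu> * (T / real N) \<noteq> 3 \<longrightarrow>
            (\<forall>\<omega>\<in>space M. \<forall>y. scheme \<mu> \<sigma> (T / real N) (\<lambda>t. W t \<omega>) N y \<longleftrightarrow>
                               implicit_scheme \<mu> \<sigma> (T / real N) (\<lambda>t. W t \<omega>) N y))
       \<and> (\<exists>p C h0 :: real. p \<ge> 1 \<and> C > 0 \<and> h0 > 0 \<and>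
            (\<forall>N>0. even N \<and> T / real N < h0 \<longrightarrow>
              (\<forall>k\<in>{1..N}.
                 integrable M
                   (\<lambda>\<omega>. \<bar>local_error \<mu> \<sigma> (T / real N) (\<lambda>t. W t \<omega>) (\<lambda>t. X t \<omega>) k\<bar>\<^sup>2) \<and>
                 (\<integral>\<omega>. \<bar>local_error \<mu> \<sigma> (T / real N) (\<lambda>t. W t \<omega>) (\<lambda>t. X t \<omega>) k\<bar>\<^sup>2 \<partial>M)
                   \<le> C * (T / real N) powr p)))"
proof -
  obtain I where ito: "has_ito_integral M F W T X I"
    and eq: "\<And>t. t \<in> {0..T} \<Longrightarrow> AE \<omega> in M. X t \<omega> = X0 \<omega> + \<mu> * (LBINT s:{0..t}. X s \<omega>) + \<sigma> * I t \<omega>"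
    and X: "adapted_on {0..T} F X" "AE \<omega> in M. continuous_on {0..T} (\<lambda>t. X t \<omega>)" "AE \<omega> in M. X 0 \<omega> = X0 \<omega>"
    using assms(6) unfolding ito_linear_solution_def by blast
  interpret wiener_space M F W
    using assms(1,2) by (simp add: wiener_space_def wiener_space_axioms_def filtered_prob_space_def)
  have X0: "X0 \<in> borel_measurable M" using measurable_F_M[OF assms(4)] by simp
  interpret linear_ito_equation M F W T X I \<mu> \<sigma> X0
    by unfold_locales (use ito eq X X0 assms in auto)
  show ?thesis
  proof (rule conjI, intro allI impI ballI)
    fix N :: nat and \<omega> y
    assume "even N \<and> \<mu> * (T / real N) \<noteq> 3"
    then show "scheme \<mu> \<sigma> (T / real N) (\<lambda>t. W t \<omega>) N y \<longleftrightarrow> implicit_scheme \<mu> \<sigma> (T / real N) (\<lambda>t. W t \<omega>) N y"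
      by (intro scheme_iff_implicit_scheme) simp
  next
    \<comment> \<open>The bound holds for every even positive \<open>N\<close>, so
      \<open>h0 = 1\<close> is an arbitrary choice; adding 1 to \<open>defect_bound\<close> makes
      the constant strictly positive.\<close>
    show "\<exists>p C h0 :: real. p \<ge> 1 \<and> C > 0 \<and> h0 > 0 \<and>
            (\<forall>N>0. even N \<and> T / real N < h0 \<longrightarrow>
              (\<forall>k\<in>{1..N}.
                 integrable M
                   (\<lambda>\<omega>. \<bar>local_error \<mu> \<sigma> (T / real N) (\<lambda>t. W t \<omega>) (\<lambda>t. X t \<omega>) k\<bar>\<^sup>2) \<and>
                 (\<integral>\<omega>. \<bar>local_error \<mu> \<sigma> (T / real N) (\<lambda>t. W t \<omega>) (\<lambda>t. X t \<omega>) k\<bar>\<^sup>2 \<partial>M)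
                   \<le> C * (T / real N) powr p))"
    proof (rule exI[of _ 1], rule exI[of _ "defect_bound + 1"], rule exI[of _ 1], intro conjI allI impI ballI)
      fix N k :: nat
      assume N: "0 < N" "even N \<and> T / real N < 1" and k: "k \<in> {1..N}"
      let ?e = "\<lambda>\<omega>. \<bar>local_error \<mu> \<sigma> (T / real N) (\<lambda>t. W t \<omega>) (\<lambda>t. X t \<omega>) k\<bar>\<^sup>2"
      show "integrable M ?e" using N k by (intro local_error_mean_square_le) auto
      have "(\<integral>\<omega>. ?e \<omega> \<partial>M) \<le> defect_bound * (T / real N)" using N k by (intro local_error_mean_square_le) auto
      also have "\<dots> \<le> (defect_bound + 1) * (T / real N)" using T_pos by (intro mult_right_mono) auto
      also have "\<dots> = (defect_bound + 1) * (T / real N) powr 1" using T_pos by simp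
      finally show "(\<integral>\<omega>. ?e \<omega> \<partial>M) \<le> (defect_bound + 1) * (T / real N) powr 1" .
    qed (use defect_bound_nonneg in auto)
  qed
qed

end
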